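(* Assume that $\mathcal{D}(A)\subset\mathcal{D}(Q^{-1/2})$, $|(-A)^{1/2}Q^{1/2}|_{\mathcal{L}_2(H)}<\infty$ and $|Q^{-1/2}(-A)^{-1}|_{\mathcal{L}(H)}<\infty$. Assume that $F\colon H\to H$ is Fréchet differentiable and that there exist $L_F,L>0$ such that $|F(u)-F(v)|\le L_F|u-v|$ for $u,v\in H$, $|F(u)|_{\dot H^1}\le L(1+|u|_{\dot H^1})$ for $u\in\dot H^1$, and $|F'(u)v|_{\dot H^2}\le L(1+|u|_{\dot H^2}^2)|v|_{\dot H^2}$ for $u,v\in\dot H^2$. Assume moreover that $F(0)=0$ and $L_F<\lambda_1$. Let $n\in\mathbb{N}^+$. Then the mapping $V^n\colon H_n\to[0,+\infty]$, $$V^n(v)=\inf\{I_{0,T}^{n,0}(z):T>0,\ z\in C([0,T];H_n),\ z(0)=0,\ z(T)=v\},$$ is a good rate function.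
   Context: $H:=L^2((0,1);\mathbb{R})$ with inner product $\langle\cdot,\cdot\rangle$ and norm $|\cdot|$; $\mathcal{L}(H)$ and $\mathcal{L}_2(H)$ are the bounded and the Hilbert–Schmidt operators on $H$. $A$ is the Dirichlet Laplacian on $(0,1)$, $\mathcal{D}(A)=H_0^1\cap H^2$; $e_i(\xi)=\sqrt2\sin(i\pi\xi)$ is an orthonormal basis of $H$ with $-Ae_i=\lambda_ie_i$, $\lambda_i=\pi^2i^2$. For $\gamma\in\mathbb{R}$, $\dot H^\gamma:=\mathcal{D}((-A)^{\gamma/2})$ with norm $|u|_{\dot H^\gamma}=|(-A)^{\gamma/2}u|$. $Q$ is a self-adjoint, positive definite bounded linear operator on $H$ with $Qe_i=q_ie_i$, $q_i>0$; $Q^{-1/2}\colon Q^{1/2}(H)\to H$ is the inverse of $Q^{1/2}$ and $\mathcal{D}(Q^{-1/2})=Q^{1/2}(H)$. $H_n:=\mathrm{span}\{e_1,\dots,e_n\}$, $P_n$ is the orthogonal projection of $H$ onto $H_n$, $A_n:=P_nA$ (on $H_n$), $F_n:=P_nF$, $Q_n^{1/2}:=P_nQ^{1/2}$. For $y\in H_n$ and $\psi\in L^2(0,T;H_n)$, $z_{0,y}^{n,\psi}\in C([0,T];H_n)$ is the unique mild solution of $\frac{dz}{dt}=A_nz+F_n(z)+Q_n^{1/2}\psi$ on $(0,T]$, $z(0)=y$, and $I_{0,T}^{n,y}(z)=\tfrac12\inf\{|\psi|_{L^2(0,T;H)}^2:\psi\in L^2(0,T;H_n),\ z_{0,y}^{n,\psi}=z\}$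 for $z\in C([0,T];H_n)$, with $\inf\emptyset=+\infty$. A rate function on a Polish space $\mathcal{U}$ is a lower semicontinuous map $I\colon\mathcal{U}\to[0,+\infty]$; it is good if all level sets $\{u\in\mathcal{U}:I(u)\le\alpha\}$, $\alpha\ge0$, are compact. *)

theory Defs
  imports "HOL-Analysis.Analysis"
begin

section \<open>The Hilbert space $L^2((0,1);\mathbb{R})$\<close>

definition square_integrable :: "(real \<Rightarrow> real) \<Rightarrow> bool" where
  "square_integrable f \<longleftrightarrow>
     f \<in> borel_measurable (lebesgue_on {0<..<1}) \<and>
     integrable (lebesgue_on {0<..<1}) (\<lambda>x. (f x)\<^sup>2)"

definition ae_rel :: "(real \<Rightarrow> real) \<Rightarrow> (real \<Rightarrow> real) \<Rightarrow> bool" where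
  "ae_rel f g \<longleftrightarrow> square_integrable f \<and> square_integrable g \<and>
     (AE x in lebesgue_on {0<..<1}. f x = g x)"

lemma square_integrable_zero: "square_integrable (\<lambda>x. 0)"
  by (simp add: square_integrable_def)

lemma square_integrable_mult:
  assumes "square_integrable f" "square_integrable g"
  shows "integrable (lebesgue_on {0<..<1}) (\<lambda>x. f x * g x)"
proof (rule Bochner_Integration.integrable_bound)
  show "integrable (lebesgue_on {0<..<1}) (\<lambda>x. (f x)\<^sup>2 + (g x)\<^sup>2)"
    using assms by (auto simp: square_integrable_def)
  show "(\<lambda>x. f x * g x) \<in> borel_measurable (lebesgue_on {0<..<1})"
    using assms by (auto simp: square_integrable_def)
  have "\<bar>a * b\<bar> \<le> a\<^sup>2 + b\<^sup>2" for a b :: real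
  proof -
    have "0 \<le> (\<bar>a\<bar> - \<bar>b\<bar>)\<^sup>2" "0 \<le> \<bar>a\<bar> * \<bar>b\<bar>" by simp_all
    then show ?thesis unfolding power2_diff abs_mult power2_abs by linarith
  qed
  then show "AE x in lebesgue_on {0<..<1}. norm (f x * g x) \<le> norm ((f x)\<^sup>2 + (g x)\<^sup>2)"
    by simp
qed

lemma square_integrable_add:
  assumes "square_integrable f" "square_integrable g"
  shows "square_integrable (\<lambda>x. f x + g x)"
  using assms square_integrable_mult[OF assms]
  by (auto simp: square_integrable_def power2_sum mult.assoc)

lemma square_integrable_scale:
  assumes "square_integrable f"
  shows "square_integrable (\<lambda>x. c * f x)"
  using assms by (auto simp: square_integrable_def power_mult_distrib)

quotient_type L2 = "real \<Rightarrow> real" / partial: ae_rel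
proof (rule part_equivpI)
  show "\<exists>x. ae_rel x x"
    using square_integrable_zero by (auto simp: ae_rel_def)
  show "symp ae_rel" by (rule sympI) (auto simp: ae_rel_def elim: eventually_mono)
  show "transp ae_rel"
    by (rule transpI) (auto simp: ae_rel_def elim: eventually_elim2)
qed

text \<open>The class of a square-integrable function; unspecified on other functions.\<close>
abbreviation to_L2 :: "(real \<Rightarrow> real) \<Rightarrow> L2" where
  "to_L2 \<equiv> abs_L2"

instantiation L2 :: real_inner
begin

lift_definition zero_L2 :: L2 is "\<lambda>x. 0"
  by (simp add: ae_rel_def square_integrable_zero)

lift_definition plus_L2 :: "L2 \<Rightarrow> L2 \<Rightarrow> L2" is "\<lambda>f g x. f x + g x"
  by (auto simp: ae_rel_def square_integrable_add elim: eventually_elim2)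

lift_definition scaleR_L2 :: "real \<Rightarrow> L2 \<Rightarrow> L2" is "\<lambda>c f x. c * f x"
  by (auto simp: ae_rel_def square_integrable_scale elim: eventually_mono)

definition uminus_L2 :: "L2 \<Rightarrow> L2" where "uminus_L2 u = (- 1) *\<^sub>R u"

definition minus_L2 :: "L2 \<Rightarrow> L2 \<Rightarrow> L2" where "minus_L2 u v = u + (- v)"

lift_definition inner_L2 :: "L2 \<Rightarrow> L2 \<Rightarrow> real"
  is "\<lambda>f g. LINT x|lebesgue_on {0<..<1}. f x * g x"
  unfolding ae_rel_def
  by (rule integral_cong_AE)
    (auto simp: square_integrable_def elim: eventually_elim2)

definition norm_L2 :: "L2 \<Rightarrow> real" where "norm_L2 u = sqrt (inner u u)"

definition sgn_L2 :: "L2 \<Rightarrow> L2" where "sgn_L2 u = inverse (norm u) *\<^sub>R u"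

definition dist_L2 :: "L2 \<Rightarrow> L2 \<Rightarrow> real" where "dist_L2 u v = norm (u - v)"

definition uniformity_L2 :: "(L2 \<times> L2) filter" where
  "uniformity_L2 = (INF e\<in>{0<..}. principal {(u, v). dist u v < e})"

definition open_L2 :: "L2 set \<Rightarrow> bool" where
  "open_L2 U \<longleftrightarrow> (\<forall>u\<in>U. eventually (\<lambda>(u', v). u' = u \<longrightarrow> v \<in> U) uniformity)"

instance
proof
  fix a b c :: L2 and r s :: real
  show "a + b + c = a + (b + c)"
    by transfer (auto simp: ae_rel_def add.assoc intro!: square_integrable_add)
  show "a + b = b + a"
    by transfer (auto simp: ae_rel_def add.commute intro!: square_integrable_add)
  show "0 + a = a"
    by transfer (auto simp: ae_rel_def)
  show "- a + a = 0"
    unfolding uminus_L2_def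
    by transfer (auto simp: ae_rel_def square_integrable_zero)
  show "a - b = a + - b" by (rule minus_L2_def)
  show "r *\<^sub>R (a + b) = r *\<^sub>R a + r *\<^sub>R b"
    by transfer (auto simp: ae_rel_def distrib_left
        intro!: square_integrable_scale square_integrable_add)
  show "(r + s) *\<^sub>R a = r *\<^sub>R a + s *\<^sub>R a"
    by transfer (auto simp: ae_rel_def distrib_right
        intro!: square_integrable_scale[of _ "r + s", unfolded distrib_right]
          square_integrable_scale square_integrable_add)
  show "r *\<^sub>R s *\<^sub>R a = (r * s) *\<^sub>R a"
    by transfer (auto simp: ae_rel_def mult.assoc
        intro!: square_integrable_scale)
  show "1 *\<^sub>R a = a"
    by transfer (auto simp: ae_rel_def)
  show "sgn a = inverse (norm a) *\<^sub>R a" by (rule sgn_L2_def)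
  show "dist a b = norm (a - b)" by (rule dist_L2_def)
  show "uniformity = (INF e\<in>{0<..}. principal {(u :: L2, v). dist u v < e})"
    by (rule uniformity_L2_def)
  show "open U \<longleftrightarrow> (\<forall>u\<in>U. eventually (\<lambda>(u', v). u' = u \<longrightarrow> v \<in> U) uniformity)"
    for U :: "L2 set" by (rule open_L2_def)
  show "inner a b = inner b a"
    by transfer (simp add: mult.commute)
  show "inner (a + b) c = inner a c + inner b c"
    by transfer (auto simp: ae_rel_def distrib_right square_integrable_mult)
  show "inner (r *\<^sub>R a) b = r * inner a b"
    by transfer (simp add: mult.assoc)
  show "0 \<le> inner a a"
    by transfer (simp add: integral_nonneg_AE)
  show "inner a a = 0 \<longleftrightarrow> a = 0"
  proof transfer
    fix f :: "real \<Rightarrow> real" assume "ae_rel f f"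
    then have f: "square_integrable f" by (simp add: ae_rel_def)
    have "(LINT x|lebesgue_on {0<..<1}. f x * f x) = 0 \<longleftrightarrow>
        (AE x in lebesgue_on {0<..<1}. f x * f x = 0)"
      by (rule integral_nonneg_eq_0_iff_AE) (use square_integrable_mult[OF f f] in auto)
    then show "(LINT x|lebesgue_on {0<..<1}. f x * f x) = 0 \<longleftrightarrow> ae_rel f (\<lambda>x. 0)"
      using f by (simp add: ae_rel_def square_integrable_zero)
  qed
  show "norm a = sqrt (inner a a)" by (rule norm_L2_def)
qed

end

section \<open>The Dirichlet Laplacian\<close>

text \<open>Test functions $C_c^1(0,1)$; a closed subset of \<open>\<real>\<close> contained in $(0,1)$ is compact.\<close>
definition test_function :: "(real \<Rightarrow> real) \<Rightarrow> bool" where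
  "test_function \<phi> \<longleftrightarrow> \<phi> C1_differentiable_on UNIV \<and> closure {x. \<phi> x \<noteq> 0} \<subseteq> {0<..<1}"

definition weak_derivative :: "L2 \<Rightarrow> L2 \<Rightarrow> bool" where
  "weak_derivative u w \<longleftrightarrow>
     (\<forall>\<phi>. test_function \<phi> \<longrightarrow> inner u (to_L2 (deriv \<phi>)) = - inner w (to_L2 \<phi>))"

definition H2 :: "L2 set" where
  "H2 = {u. \<exists>v w. weak_derivative u v \<and> weak_derivative v w}"

text \<open>$H_0^1(0,1)$ is the closure of $C_c^1(0,1)$ in the norm of $H^1(0,1)$.\<close>
definition H10 :: "L2 set" where
  "H10 = {u. \<exists>v \<phi>. weak_derivative u v \<and> (\<forall>k. test_function (\<phi> k)) \<and>
            (\<lambda>k. to_L2 (\<phi> k)) \<longlonglongrightarrow> u \<and> (\<lambda>k. to_L2 (deriv (\<phi> k))) \<longlonglongrightarrow> v}"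

definition dom_A :: "L2 set" where
  "dom_A = H10 \<inter> H2"

text \<open>Meaningful on \<open>dom_A\<close> only; there the second weak derivative exists and is unique.\<close>
definition lap :: "L2 \<Rightarrow> L2" where
  "lap u = (THE w. \<exists>v. weak_derivative u v \<and> weak_derivative v w)"

text \<open>The eigenbasis and the eigenvalues of \<open>- lap\<close> are indexed by \<open>i \<ge> 1\<close>.\<close>
definition eigenfun :: "nat \<Rightarrow> L2" where
  "eigenfun i = to_L2 (\<lambda>\<xi>. sqrt 2 * sin (real i * pi * \<xi>))"

definition eigenval :: "nat \<Rightarrow> real" where
  "eigenval i = pi\<^sup>2 * (real i)\<^sup>2"

section \<open>Functions of operators diagonal in the eigenbasis\<close>

text \<open>The operator $u \mapsto \sum_{i \ge 1} c_i \langle u, e_i\rangle e_i$, meaningful for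
  \<open>u \<in> diag_dom c\<close>. An operator \<open>T\<close> with $T e_i = t_i e_i$ has $f(T)$ given by $c_i = f(t_i)$.\<close>
definition diag_op :: "(nat \<Rightarrow> real) \<Rightarrow> L2 \<Rightarrow> L2" where
  "diag_op c u = (\<Sum>i. (c (Suc i) * inner u (eigenfun (Suc i))) *\<^sub>R eigenfun (Suc i))"

definition diag_dom :: "(nat \<Rightarrow> real) \<Rightarrow> L2 set" where
  "diag_dom c = {u. summable (\<lambda>i. (c (Suc i) * inner u (eigenfun (Suc i)))\<^sup>2)}"

text \<open>$(-A)^s$\<close>
definition neg_lap_pow :: "real \<Rightarrow> L2 \<Rightarrow> L2" where
  "neg_lap_pow s = diag_op (\<lambda>i. eigenval i powr s)"

definition Hdot :: "real \<Rightarrow> L2 set" where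
  "Hdot \<gamma> = diag_dom (\<lambda>i. eigenval i powr (\<gamma> / 2))"

definition Hdot_norm :: "real \<Rightarrow> L2 \<Rightarrow> real" where
  "Hdot_norm \<gamma> u = norm (neg_lap_pow (\<gamma> / 2) u)"

text \<open>$Q^{1/2}$ for \<open>Q\<close> diagonal in the eigenbasis, where $q_i = \langle Q e_i, e_i\rangle$.\<close>
definition sqrt_op :: "(L2 \<Rightarrow> L2) \<Rightarrow> L2 \<Rightarrow> L2" where
  "sqrt_op Q = diag_op (\<lambda>i. sqrt (inner (Q (eigenfun i)) (eigenfun i)))"

text \<open>The Hilbert--Schmidt norm does not depend on the orthonormal basis in which it is computed.\<close>
definition hilbert_schmidt :: "(L2 \<Rightarrow> L2) \<Rightarrow> bool" where
  "hilbert_schmidt T \<longleftrightarrow> bounded_linear T \<and> summable (\<lambda>i. (norm (T (eigenfun (Suc i))))\<^sup>2)"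

section \<open>Galerkin approximation and the controlled equation\<close>

definition Hn :: "nat \<Rightarrow> L2 set" where
  "Hn n = span (eigenfun ` {1..n})"

text \<open>The orthogonal projection onto \<open>Hn n\<close>.\<close>
definition Pn :: "nat \<Rightarrow> L2 \<Rightarrow> L2" where
  "Pn n u = (THE v. v \<in> Hn n \<and> (\<forall>h\<in>Hn n. orthogonal (u - v) h))"

definition An :: "nat \<Rightarrow> L2 \<Rightarrow> L2" where
  "An n u = Pn n (lap u)"

text \<open>$e^{tA_n}$ on \<open>Hn n\<close>, where \<open>An n\<close> is bounded.\<close>
definition exp_An :: "nat \<Rightarrow> real \<Rightarrow> L2 \<Rightarrow> L2" where
  "exp_An n t y = (\<Sum>k. (t ^ k / fact k) *\<^sub>R (An n ^^ k) y)"

text \<open>$C([0,T];H_n)$; values outside $[0,T]$ are irrelevant.\<close>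
definition paths :: "nat \<Rightarrow> real \<Rightarrow> (real \<Rightarrow> L2) set" where
  "paths n T = {z. continuous_on {0..T} z \<and> z ` {0..T} \<subseteq> Hn n}"

text \<open>$L^2(0,T;H_n)$\<close>
definition controls :: "nat \<Rightarrow> real \<Rightarrow> (real \<Rightarrow> L2) set" where
  "controls n T = {\<psi>. \<psi> \<in> borel_measurable (lebesgue_on {0<..<T}) \<and> \<psi> ` {0<..<T} \<subseteq> Hn n \<and>
     integrable (lebesgue_on {0<..<T}) (\<lambda>t. (norm (\<psi> t))\<^sup>2)}"

text \<open>\<open>mild_solution F Q n T y \<psi> z\<close> says $z = z^{n,\psi}_{0,y}$ on $[0,T]$:
  $z(t) = e^{tA_n}y + \int_0^t e^{(t-s)A_n}(F_n(z(s)) + Q_n^{1/2}\psi(s))\,ds$.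
  The integrand is integrable with values in the finite-dimensional space $H_n$, so the
  Henstock--Kurzweil integral used here is the Bochner integral.\<close>
definition mild_solution ::
  "(L2 \<Rightarrow> L2) \<Rightarrow> (L2 \<Rightarrow> L2) \<Rightarrow> nat \<Rightarrow> real \<Rightarrow> L2 \<Rightarrow> (real \<Rightarrow> L2) \<Rightarrow> (real \<Rightarrow> L2) \<Rightarrow> bool" where
  "mild_solution F Q n T y \<psi> z \<longleftrightarrow> z \<in> paths n T \<and>
     (\<forall>t\<in>{0..T}. ((\<lambda>s. exp_An n (t - s) (Pn n (F (z s)) + Pn n (sqrt_op Q (\<psi> s))))
        has_integral (z t - exp_An n t y)) {0..t})"

text \<open>$I^{n,y}_{0,T}$; in \<^typ>\<open>ennreal\<close> the infimum of the empty set is $+\infty$.\<close>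
definition action ::
  "(L2 \<Rightarrow> L2) \<Rightarrow> (L2 \<Rightarrow> L2) \<Rightarrow> nat \<Rightarrow> real \<Rightarrow> L2 \<Rightarrow> (real \<Rightarrow> L2) \<Rightarrow> ennreal" where
  "action F Q n T y z =
     (INF \<psi>\<in>{\<psi> \<in> controls n T. mild_solution F Q n T y \<psi> z}.
        ennreal (LINT t|lebesgue_on {0<..<T}. (norm (\<psi> t))\<^sup>2)) / 2"

definition quasi_potential :: "(L2 \<Rightarrow> L2) \<Rightarrow> (L2 \<Rightarrow> L2) \<Rightarrow> nat \<Rightarrow> L2 \<Rightarrow> ennreal" where
  "quasi_potential F Q n v =
     Inf {action F Q n T 0 z | T z. T > 0 \<and> z \<in> paths n T \<and> z 0 = 0 \<and> z T = v}"

section \<open>Rate functions\<close>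

text \<open>Lower semicontinuity on the space \<open>X\<close>: strict superlevel sets are open.\<close>
definition rate_function :: "'a topology \<Rightarrow> ('a \<Rightarrow> ennreal) \<Rightarrow> bool" where
  "rate_function X I \<longleftrightarrow> (\<forall>\<alpha>. openin X {u \<in> topspace X. \<alpha> < I u})"

definition good_rate_function :: "'a topology \<Rightarrow> ('a \<Rightarrow> ennreal) \<Rightarrow> bool" where
  "good_rate_function X I \<longleftrightarrow> rate_function X I \<and>
     (\<forall>\<alpha>::real. \<alpha> \<ge> 0 \<longrightarrow> compactin X {u \<in> topspace X. I u \<le> ennreal \<alpha>})"

end

theory Submission
  imports Defs
begin

text \<open>On \<open>Hn n\<close> the operator $Q^{1/2}$ is invertible, so a segment from \<open>v'\<close> to \<open>v\<close> can be followed
  at unit speed by a control whose norm stays bounded as \<open>v'\<close> ranges over a neighbourhood of \<open>v\<close>.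
  Appending such a segment to a path ending in \<open>v'\<close> gives $V^n(v) \le V^n(v') + K |v - v'|$ locally,
  hence lower semicontinuity, with no compactness of minimising paths. Since $L_F < \lambda_1$,
  the supremum of $|z|$ over $[0,T]$ can be absorbed in the mild formulation; this bounds $|z(T)|$ by
  the energy of the control, uniformly in $T$, so the closed level sets are bounded in a
  finite-dimensional space.\<close>

section \<open>Weak derivatives of smooth functions\<close>

text \<open>\<open>lap\<close> and \<open>Pn\<close> are definite descriptions, so nothing can be
  computed with \<open>An n\<close> until weak derivatives are known to be unique; hence the initial
  work on test functions separating the points of \<open>L2\<close>. Once \<open>An n\<close>, its
  exponential and \<open>sqrt_op Q\<close> are identified as diagonal on \<open>Hn n\<close>, the
  mild equation splits into n real equations, and both halves of the proof use only real integrals.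
  The role of lambda_1: the slowest mode decays at rate lambda_1, and the integral of exp(-lambda_1
  (t - s)) over 0 <= s <= t is at most 1/lambda_1 for every t. A forcing of size at most L_F sup |z|
  therefore contributes at most (L_F / lambda_1) sup |z|, with a factor below 1 independent of the
  time horizon. The control of the segment y is obtained by solving y' = A_n y + F_n(y) + Q_n^{1/2}
  eta for eta.\<close>

lemma inner_to_L2:
  assumes "square_integrable f" "square_integrable g"
  shows "inner (to_L2 f) (to_L2 g) = (LINT x|lebesgue_on {0<..<1}. f x * g x)"
  using assms by (intro inner_L2.abs_eq) (auto simp: ae_rel_def)

lemma to_L2_cases:
  obtains f where "square_integrable f" "w = to_L2 f"
proof -
  have "ae_rel (rep_L2 w) (rep_L2 w)" "abs_L2 (rep_L2 w) = w"
    using Quotient3_rep_reflp[OF Quotient3_L2] Quotient3_abs_rep[OF Quotient3_L2] by auto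
  then show thesis using that[of "rep_L2 w"] by (auto simp: ae_rel_def)
qed

lemma integrable_Ioo_continuous:
  fixes f :: "real \<Rightarrow> real"
  assumes "continuous_on {a..b} f"
  shows "integrable (lebesgue_on {a<..<b}) f"
    and "(LINT x|lebesgue_on {a<..<b}. f x) = integral {a..b} f"
proof -
  have "integrable (lebesgue_on {a..b}) f"
    using assms by (rule continuous_imp_integrable_real)
  then have "set_integrable lebesgue {a..b} f"
    by (simp add: set_integrable_def integrable_restrict_space)
  then have "set_integrable lebesgue {a<..<b} f"
    by (rule set_integrable_subset) auto
  then show i: "integrable (lebesgue_on {a<..<b}) f"
    by (simp add: set_integrable_def integrable_restrict_space)
  show "(LINT x|lebesgue_on {a<..<b}. f x) = integral {a..b} f"
    using lebesgue_integral_eq_integral[OF i] by (simp add: integral_open_interval_real)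
qed

lemma square_integrable_continuous:
  assumes "continuous_on {0..1} f"
  shows "square_integrable f"
  unfolding square_integrable_def
  using integrable_Ioo_continuous(1)[OF assms]
    integrable_Ioo_continuous(1)[of 0 1 "\<lambda>x. (f x)\<^sup>2"] assms
  by (auto intro!: continuous_intros)

lemma inner_to_L2_continuous:
  assumes "continuous_on {0..1} f" "continuous_on {0..1} g"
  shows "inner (to_L2 f) (to_L2 g) = integral {0..1} (\<lambda>x. f x * g x)"
  using assms by (simp add: inner_to_L2 square_integrable_continuous
      integrable_Ioo_continuous continuous_on_mult)

lemma to_L2_scale:
  assumes "square_integrable f"
  shows "to_L2 (\<lambda>x. c * f x) = c *\<^sub>R to_L2 f"
  using assms by (subst scaleR_L2.abs_eq) (auto simp: ae_rel_def)

lemma integrable_square_integrable: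
  assumes "square_integrable f"
  shows "integrable (lebesgue_on {0<..<1}) f"
  using square_integrable_mult[OF assms, of "\<lambda>_. 1"]
  by (simp add: square_integrable_continuous)

lemma test_functionD:
  assumes "test_function \<phi>"
  shows "(\<phi> has_real_derivative deriv \<phi> x) (at x)" "continuous_on A (deriv \<phi>)"
    "continuous_on A \<phi>" "\<phi> 0 = 0" "\<phi> 1 = 0"
proof -
  have C: "\<phi> C1_differentiable_on UNIV" using assms by (simp add: test_function_def)
  then have d: "\<phi> differentiable at x" for x
    by (simp add: C1_differentiable_on_eq)
  show D: "(\<phi> has_real_derivative deriv \<phi> x) (at x)" for x
    using d DERIV_deriv_iff_real_differentiable by blast
  then have "vector_derivative \<phi> (at x) = deriv \<phi> x" for x
    by (intro vector_derivative_at) (simp flip: has_real_derivative_iff_has_vector_derivative)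
  then show "continuous_on A (deriv \<phi>)"
    using C continuous_on_subset[of UNIV "deriv \<phi>" A] by (simp add: C1_differentiable_on_eq)
  show "continuous_on A \<phi>"
    by (meson D DERIV_isCont continuous_at_imp_continuous_on)
  have "x \<notin> closure {x. \<phi> x \<noteq> 0}" if "x = 0 \<or> x = 1" for x
    using assms that by (auto simp: test_function_def)
  then show "\<phi> 0 = 0" "\<phi> 1 = 0" using closure_subset[of "{x. \<phi> x \<noteq> 0}"] by blast+
qed

text \<open>Integration by parts: the boundary terms vanish because test functions are zero at 0 and
  1, so \<open>f\<close> may take any boundary values. The cosines arising as derivatives of the
  eigenfunctions need this freedom.\<close>

lemma weak_derivative_C1:
  assumes "\<And>x. (f has_real_derivative f' x) (at x)" "continuous_on UNIV f'"
  shows "weak_derivative (to_L2 f) (to_L2 f')"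
  unfolding weak_derivative_def
proof (intro allI impI)
  fix \<phi> assume \<phi>: "test_function \<phi>"
  note t = test_functionD[OF \<phi>]
  have c: "continuous_on A f" "continuous_on A f'" for A
    by (meson DERIV_isCont assms(1) continuous_at_imp_continuous_on)
      (rule continuous_on_subset[OF assms(2)], simp)
  have "((\<lambda>x. f x * deriv \<phi> x + f' x * \<phi> x) has_integral (f 1 * \<phi> 1 - f 0 * \<phi> 0)) {0..1}"
  proof (rule fundamental_theorem_of_calculus)
    fix x :: real
    have "((\<lambda>x. f x * \<phi> x) has_real_derivative f x * deriv \<phi> x + f' x * \<phi> x) (at x)"
      using DERIV_mult[OF assms(1) t(1), of x] by (simp add: add.commute mult.commute)
    then show "((\<lambda>x. f x * \<phi> x) has_vector_derivative f x * deriv \<phi> x + f' x * \<phi> x) (at x within {0..1})"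
      by (simp add: has_real_derivative_iff_has_vector_derivative has_vector_derivative_at_within)
  qed simp
  moreover have "(\<lambda>x. f x * deriv \<phi> x) integrable_on {0..1}" "(\<lambda>x. f' x * \<phi> x) integrable_on {0..1}"
    by (intro integrable_continuous_real continuous_on_mult c t)+
  ultimately have "integral {0..1} (\<lambda>x. f x * deriv \<phi> x) + integral {0..1} (\<lambda>x. f' x * \<phi> x) = 0"
    using t by (simp flip: integral_add add: integral_unique)
  then show "inner (to_L2 f) (to_L2 (deriv \<phi>)) = - inner (to_L2 f') (to_L2 \<phi>)"
    by (simp add: inner_to_L2_continuous c t)
qed

text \<open>A C1 substitute for the indicator of an interval. The parabola k (x - a)(b - x) - 1 is
  nonnegative only inside (a, b), and squaring its positive part gives a C1 function p. Passing to p
  / (1 + p) keeps the values in [0, 1), as dominated convergence will require, while p tends to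
  infinity at each point of (a, b).\<close>

lemma test_function_bump:
  assumes "0 \<le> a" "a < b" "b \<le> 1"
  defines "p \<equiv> \<lambda>k x. (max 0 (real k * ((x - a) * (b - x)) - 1))\<^sup>2"
  shows "test_function (\<lambda>x. p k x / (1 + p k x))"
    "(\<lambda>k. p k x / (1 + p k x)) \<longlonglongrightarrow> indicator {a<..<b} x"
proof -
  let ?r = "\<lambda>x. real k * ((x - a) * (b - x)) - 1"
  \<comment> \<open>The square removes the kink of the positive part: at 0 the difference quotient
    is bounded by |h|.\<close>
  have sq: "((\<lambda>y. (max 0 y)\<^sup>2) has_real_derivative 2 * max 0 y) (at y)" for y :: real
  proof (cases "y = 0")
    case True
    have "((\<lambda>h::real. ((max 0 h)\<^sup>2 - 0) / h) \<longlongrightarrow> 0) (at 0)"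
    proof (rule Lim_null_comparison)
      show "\<forall>\<^sub>F h in at 0. norm (((max 0 h)\<^sup>2 - 0) / h) \<le> \<bar>h::real\<bar>"
        by (rule always_eventually) (auto simp: max_def power2_eq_square)
      show "((\<lambda>h::real. \<bar>h\<bar>) \<longlongrightarrow> 0) (at 0)" by (auto intro!: tendsto_eq_intros)
    qed
    then show ?thesis using True by (simp add: DERIV_def)
  next
    case False
    then consider "y > 0" | "y < 0" by linarith
    then show ?thesis
    proof cases
      case 1
      have "((\<lambda>y. y\<^sup>2) has_real_derivative 2 * max 0 y) (at y)"
        using 1 by (auto intro!: derivative_eq_intros)
      then show ?thesis
        by (rule has_field_derivative_transform_within_open[of _ _ _ "{0<..}"]) (use 1 in auto)
    next
      case 2
      have "((\<lambda>y. 0) has_real_derivative 2 * max 0 y) (at y)"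
        using 2 by (auto intro!: derivative_eq_intros)
      then show ?thesis
        by (rule has_field_derivative_transform_within_open[of _ _ _ "{..<0}"]) (use 2 in auto)
    qed
  qed
  define p' where "p' x = 2 * max 0 (?r x) * (real k * ((b - x) - (x - a)))" for x
  have dp: "(p k has_real_derivative p' x) (at x)" for x
    unfolding p_def p'_def
    by (rule DERIV_chain2[OF sq]) (auto intro!: derivative_eq_intros simp: algebra_simps)
  have pos: "0 < 1 + p k x" for k x by (auto simp: p_def add_pos_nonneg)
  have D: "((\<lambda>x. p k x / (1 + p k x)) has_real_derivative p' x / (1 + p k x)\<^sup>2) (at x)" for x
    using pos[of k x] by (auto intro!: derivative_eq_intros dp simp: field_simps power2_eq_square)
  have cp: "continuous_on UNIV (p k)" "continuous_on UNIV p'"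
    unfolding p_def p'_def by (auto intro!: continuous_intros)
  have "continuous_on UNIV (\<lambda>x. p' x / (1 + p k x)\<^sup>2)"
    by (intro continuous_intros cp) (use pos[of k] in \<open>auto simp: less_imp_neq[symmetric]\<close>)
  then have C1: "(\<lambda>x. p k x / (1 + p k x)) C1_differentiable_on UNIV"
    unfolding C1_differentiable_on_def using D[unfolded has_real_derivative_iff_has_vector_derivative]
    by (intro exI[of _ "\<lambda>x. p' x / (1 + p k x)\<^sup>2"]) auto
  \<comment> \<open>The closed set where k (x - a)(b - x) >= 1 contains the support and misses a and
    b, so the closure stays inside (0, 1) even if a = 0 or b = 1.\<close>
  have "closure {x. p k x / (1 + p k x) \<noteq> 0} \<subseteq> {x. 0 \<le> ?r x}"
    by (rule closure_minimal) (auto simp: p_def max_def split: if_splits intro!: closed_Collect_le continuous_intros)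
  also have "\<dots> \<subseteq> {0<..<1}"
  proof
    fix x assume "x \<in> {x. 0 \<le> ?r x}"
    then have "0 < real k * ((x - a) * (b - x))" by simp
    then have "0 < (x - a) * (b - x)" by (simp add: zero_less_mult_iff)
    then have "a < x \<and> x < b" using assms by (auto simp: zero_less_mult_iff)
    then show "x \<in> {0<..<1}" using assms by auto
  qed
  finally show "test_function (\<lambda>x. p k x / (1 + p k x))"
    using C1 by (simp add: test_function_def)
  show "(\<lambda>k. p k x / (1 + p k x)) \<longlonglongrightarrow> indicator {a<..<b} x"
  proof (cases "x \<in> {a<..<b}")
    case True
    define d where "d = (x - a) * (b - x)"
    have d: "d > 0" using True by (simp add: d_def)
    have "filterlim (\<lambda>k. - 1 + d * real k) at_top sequentially"
      by (intro filterlim_tendsto_add_at_top[OF tendsto_const]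
          filterlim_tendsto_pos_mult_at_top[OF tendsto_const d] filterlim_real_sequentially)
    then have lim: "filterlim (\<lambda>k. max 0 (real k * d - 1)) at_top sequentially"
      by (rule filterlim_at_top_mono) (auto simp: algebra_simps)
    have "filterlim (\<lambda>k. 1 + p k x) at_top sequentially"
      unfolding p_def d_def[symmetric]
      by (intro filterlim_tendsto_add_at_top[OF tendsto_const] filterlim_pow_at_top lim) simp
    then have "(\<lambda>k. 1 - inverse (1 + p k x)) \<longlonglongrightarrow> 1 - 0"
      by (intro tendsto_diff tendsto_const tendsto_inverse_0_at_top)
    moreover have "1 - inverse (1 + p k x) = p k x / (1 + p k x)" for k
      using pos[of k x] by (simp add: field_simps)
    ultimately show ?thesis using True by simp
  next
    case False
    then have "(x - a) * (b - x) \<le> 0" using assms by (auto simp: mult_le_0_iff)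
    then have "real k * ((x - a) * (b - x)) \<le> 0" for k by (simp add: mult_nonneg_nonpos)
    then have "p k x = 0" for k unfolding p_def by (smt (verit) power_zero_numeral)
    then show ?thesis using False by simp
  qed
qed

section \<open>Uniqueness of weak derivatives and the eigenbasis\<close>

text \<open>The measures with densities f^+ and f^- agree on half-lines, hence on all Borel sets.
  The set where f > 0 is not charged by f^-, hence not by f^+ either.\<close>

lemma AE_nonpos_if_integral_Ioi_eq_0:
  fixes f :: "real \<Rightarrow> real"
  assumes f: "integrable lebesgue f"
    and zero: "\<And>a. (\<integral>x. f x * indicator {a<..} x \<partial>lebesgue) = 0"
  shows "AE x in lebesgue. f x \<le> 0"
proof -
  have fm [measurable]: "f \<in> borel_measurable lebesgue" using f by simp
  \<comment> \<open>\<open>ennreal\<close> sends negative reals to 0, so \<open>M f\<close> and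
    \<open>M (\<lambda>x. - f x)\<close> have densities f^+ and f^-. The image under the identity
    moves them to the Borel sigma-algebra, where half-lines determine them.\<close>
  define M where "M h = distr (density lebesgue (\<lambda>x. ennreal (h x))) borel (\<lambda>x. x)"
    for h :: "real \<Rightarrow> real"
  have idm: "(\<lambda>x. x) \<in> measurable (density lebesgue h) borel" for h :: "real \<Rightarrow> ennreal"
    by (simp add: measurable_completion)
  have M: "emeasure (M h) A = (\<integral>\<^sup>+x. ennreal (h x * indicator A x) \<partial>lebesgue)"
    if "A \<in> sets borel" "h \<in> borel_measurable lebesgue" for h A
  proof -
    have A: "A \<in> sets lebesgue" using that by (simp add: sets_completionI_sets)
    show ?thesis
      using that A unfolding M_def
      by (subst emeasure_distr[OF idm])
        (auto simp: emeasure_density intro!: nn_integral_cong split: split_indicator)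
  qed
  have "M f = M (\<lambda>x. - f x)"
  proof (rule measure_eqI_lessThan)
    fix a :: real
    let ?f = "\<lambda>x. f x * indicator {a<..} x"
    have "integrable lebesgue ?f"
      using integrable_mult_indicator[OF _ f, of "{a<..}"] by (simp add: mult.commute)
    then have fin: "(\<integral>\<^sup>+x. ennreal (?f x) \<partial>lebesgue) < \<infinity>" "(\<integral>\<^sup>+x. ennreal (- ?f x) \<partial>lebesgue) < \<infinity>"
      by (auto simp: real_integrable_def less_top)
    then have "(\<integral>\<^sup>+x. ennreal (?f x) \<partial>lebesgue) = (\<integral>\<^sup>+x. ennreal (- ?f x) \<partial>lebesgue)"
      using zero[of a] real_lebesgue_integral_def[OF \<open>integrable lebesgue ?f\<close>]
      by (metis ennreal_enn2real eq_iff_diff_eq_0 infinity_ennreal_def)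
    then show "emeasure (M f) {a<..} = emeasure (M (\<lambda>x. - f x)) {a<..}" by (simp add: M)
    show "emeasure (M f) {a<..} < \<infinity>" using fin by (simp add: M)
  qed (auto simp: M_def)
  \<comment> \<open>\<open>M\<close> lives on Borel sets, but the set where f > 0 is only Lebesgue
    measurable; a Borel version \<open>g\<close> supplies a Borel replacement.\<close>
  moreover obtain g where g: "g \<in> borel_measurable borel" "AE x in lebesgue. f x = g x"
    using completion_ex_borel_measurable_real[OF fm] AE_completion by auto
  define A where "A = {x. g x > 0}"
  have A: "A \<in> sets borel" using g(1) by (simp add: A_def)
  have A': "A \<in> sets lebesgue" using A by (simp add: sets_completionI_sets)
  have "AE x in lebesgue. ennreal (- f x * indicator A x) = 0"
    using g(2) by eventually_elim (auto simp: A_def ennreal_eq_0_iff split: split_indicator)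
  then have "emeasure (M (\<lambda>x. - f x)) A = 0"
    using A' by (subst M[OF A]) (auto simp: nn_integral_0_iff_AE)
  ultimately have "emeasure (M f) A = 0" by simp
  then have "(\<integral>\<^sup>+x. ennreal (f x * indicator A x) \<partial>lebesgue) = 0" by (simp add: M A)
  then have "AE x in lebesgue. ennreal (f x * indicator A x) = 0"
    using A' by (subst (asm) nn_integral_0_iff_AE) auto
  with g(2) show ?thesis by eventually_elim (auto simp: A_def ennreal_eq_0_iff split: split_indicator_asm)
qed

lemma AE_eq_0_if_integral_Ioi_eq_0:
  fixes f :: "real \<Rightarrow> real"
  assumes f: "integrable lebesgue f"
    and zero: "\<And>a. (\<integral>x. f x * indicator {a<..} x \<partial>lebesgue) = 0"
  shows "AE x in lebesgue. f x = 0"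
  using AE_nonpos_if_integral_Ioi_eq_0[OF f zero] AE_nonpos_if_integral_Ioi_eq_0[of "\<lambda>x. - f x"] f zero
  by (auto elim: eventually_elim2)

text \<open>The bumps converge to indicators, so a representative f integrates to 0 over
  subintervals of (0, 1). Domination is by |f|, which is integrable because (0, 1) has finite
  measure.\<close>

lemma orthogonal_test_functions_eq_0:
  assumes "\<And>\<phi>. test_function \<phi> \<Longrightarrow> inner w (to_L2 \<phi>) = 0"
  shows "w = 0"
proof -
  obtain f where f: "square_integrable f" and w: "w = to_L2 f" by (rule to_L2_cases)
  let ?M = "lebesgue_on {0<..<1::real}"
  note fi = integrable_square_integrable[OF f]
  have fm: "f \<in> borel_measurable ?M" using f by (simp add: square_integrable_def)
  have Ioo: "(LINT x|?M. f x * indicator {a<..<b} x) = 0" if ab: "0 \<le> a" "a < b" "b \<le> 1" for a b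
  proof -
    define \<phi> where "\<phi> k = (\<lambda>x. (max 0 (real k * ((x - a) * (b - x)) - 1))\<^sup>2
        / (1 + (max 0 (real k * ((x - a) * (b - x)) - 1))\<^sup>2))" for k
    have \<phi>: "test_function (\<phi> k)" "(\<lambda>k. \<phi> k x) \<longlonglongrightarrow> indicator {a<..<b} x" for k x
      using test_function_bump[OF ab] by (simp_all add: \<phi>_def)
    have b: "\<bar>\<phi> k x\<bar> \<le> 1" for k x
      by (simp add: \<phi>_def abs_divide divide_le_eq add_pos_nonneg)
    have sq: "square_integrable (\<phi> k)" for k
      using \<phi>(1) by (intro square_integrable_continuous test_functionD)
    have "(\<lambda>k. LINT x|?M. f x * \<phi> k x) \<longlonglongrightarrow> (LINT x|?M. f x * indicator {a<..<b} x)"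
    proof (rule integral_dominated_convergence[where w = "\<lambda>x. \<bar>f x\<bar>"])
      show "AE x in ?M. (\<lambda>k. f x * \<phi> k x) \<longlonglongrightarrow> f x * indicator {a<..<b} x"
        using \<phi> by (intro always_eventually allI tendsto_mult tendsto_const)
      show "AE x in ?M. norm (f x * \<phi> k x) \<le> \<bar>f x\<bar>" for k
        using b by (intro always_eventually allI) (simp add: abs_mult mult_left_le)
      show "(\<lambda>x. f x * \<phi> k x) \<in> borel_measurable ?M" for k
        using fm sq[of k] by (intro borel_measurable_times) (simp_all add: square_integrable_def)
      have "{a<..<b} \<inter> {0<..<1} \<in> sets ?M"
        by (auto simp: sets_restrict_space_iff)
      moreover have "{a<..<b} \<inter> {0<..<1} = {a<..<b} \<inter> space ?M" by simp
      ultimately have "(\<lambda>x. indicator {a<..<b} x :: real) \<in> borel_measurable ?M"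
        by (subst borel_measurable_indicator_iff) simp
      then show "(\<lambda>x. f x * indicator {a<..<b} x) \<in> borel_measurable ?M"
        using fm by simp
    qed (use fi in simp)
    moreover have "(LINT x|?M. f x * \<phi> k x) = 0" for k
      using assms[OF \<phi>(1)] by (simp add: w inner_to_L2 f sq)
    ultimately show ?thesis by (simp add: LIMSEQ_const_iff)
  qed
  \<comment> \<open>Extended by zero to the line, f meets a half-line in the interval (max 0 a, 1),
    or not at all when a >= 1.\<close>
  let ?g = "\<lambda>x. indicator {0<..<1} x * f x"
  have gi: "integrable lebesgue ?g" using fi by (simp add: integrable_restrict_space)
  have Ioi: "(\<integral>x. ?g x * indicator {a<..} x \<partial>lebesgue) = 0" for a
  proof (cases "a < 1")
    case True
    have "?g x * indicator {a<..} x = indicator {0<..<1} x *\<^sub>R (f x * indicator {max 0 a<..<1} x)" for x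
      by (auto split: split_indicator)
    then have "(\<integral>x. ?g x * indicator {a<..} x \<partial>lebesgue) = (LINT x|?M. f x * indicator {max 0 a<..<1} x)"
      by (simp only:) (simp add: integral_restrict_space)
    then show ?thesis using Ioo[of "max 0 a" 1] True by simp
  next
    case False
    then have "?g x * indicator {a<..} x = 0" for x by (auto split: split_indicator)
    then show ?thesis by (simp only: lebesgue_integral_const mult_zero_right scaleR_zero_right Bochner_Integration.integral_zero)
  qed
  have "AE x in lebesgue. ?g x = 0" by (rule AE_eq_0_if_integral_Ioi_eq_0[OF gi Ioi])
  then have "AE x in ?M. f x = 0"
    by (subst AE_restrict_space_iff) (auto elim!: eventually_mono split: split_indicator_asm)
  then have "ae_rel f (\<lambda>x. 0)" using f by (simp add: ae_rel_def square_integrable_zero)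
  then show "w = 0" unfolding w zero_L2_def by (rule Quotient3_rel_abs[OF Quotient3_L2])
qed

lemma weak_derivative_unique:
  assumes "weak_derivative u v" "weak_derivative u w"
  shows "v = w"
  using orthogonal_test_functions_eq_0[of "v - w"] assms
  by (auto simp: weak_derivative_def inner_diff_left)

section \<open>The Laplacian on combinations of sines, and orthonormality of the sines\<close>

lemma weak_derivative_sum:
  assumes "\<And>i. i \<in> I \<Longrightarrow> weak_derivative (u i) (v i)"
  shows "weak_derivative (\<Sum>i\<in>I. c i *\<^sub>R u i) (\<Sum>i\<in>I. c i *\<^sub>R v i)"
  using assms by (simp add: weak_derivative_def inner_sum_left sum_negf)

lemma lap_eqI:
  assumes "weak_derivative u v" "weak_derivative v w"
  shows "lap u = w"
  unfolding lap_def using assms weak_derivative_unique by (intro the_equality) blast+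

lemma lap_sum_eigenfun:
  "lap (\<Sum>i\<in>I. c i *\<^sub>R eigenfun i) = (\<Sum>i\<in>I. (- eigenval i * c i) *\<^sub>R eigenfun i)"
proof -
  define d where "d i = to_L2 (\<lambda>x. sqrt 2 * (real i * pi) * cos (real i * pi * x))" for i
  have 1: "weak_derivative (eigenfun i) (d i)" for i
    unfolding eigenfun_def d_def
    by (intro weak_derivative_C1) (auto intro!: derivative_eq_intros continuous_intros)
  have "weak_derivative (d i) (to_L2 (\<lambda>x. - eigenval i * (sqrt 2 * sin (real i * pi * x))))" for i
    unfolding d_def eigenval_def
    by (intro weak_derivative_C1)
      (auto intro!: derivative_eq_intros continuous_intros simp: power2_eq_square)
  then have 2: "weak_derivative (d i) (- eigenval i *\<^sub>R eigenfun i)" for i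
    by (subst (asm) to_L2_scale) (auto intro!: square_integrable_continuous continuous_intros simp: eigenfun_def)
  have "lap (\<Sum>i\<in>I. c i *\<^sub>R eigenfun i) = (\<Sum>i\<in>I. c i *\<^sub>R - eigenval i *\<^sub>R eigenfun i)"
    by (rule lap_eqI; rule weak_derivative_sum; rule 1 2)
  then show ?thesis by (simp add: mult.commute)
qed

lemma inner_eigenfun:
  assumes "i \<ge> 1" "j \<ge> 1"
  shows "inner (eigenfun i) (eigenfun j) = (if i = j then 1 else 0)"
proof -
  have inner: "inner (eigenfun i) (eigenfun j)
      = integral {0..1} (\<lambda>x. 2 * (sin (real i * pi * x) * sin (real j * pi * x)))"
    unfolding eigenfun_def
    by (subst inner_to_L2_continuous)
      (auto intro!: continuous_intros integral_cong simp del: integral_mult_right simp: algebra_simps)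
  show ?thesis
  proof (cases "i = j")
    case True
    let ?F = "\<lambda>x. x - sin (2 * (real i * pi) * x) / (2 * (real i * pi))"
    have "((\<lambda>x. 2 * (sin (real i * pi * x) * sin (real i * pi * x))) has_integral (?F 1 - ?F 0)) {0..1}"
    proof (rule fundamental_theorem_of_calculus)
      fix x :: real
      have "(?F has_real_derivative 1 - cos (2 * (real i * pi) * x)) (at x)"
        using assms by (auto intro!: derivative_eq_intros)
      also have "1 - cos (2 * (real i * pi) * x) = 2 * (sin (real i * pi * x) * sin (real i * pi * x))"
        using cos_double_sin[of "real i * pi * x"] by (simp add: power2_eq_square mult.assoc)
      finally show "(?F has_vector_derivative 2 * (sin (real i * pi * x) * sin (real i * pi * x))) (at x within {0..1})"
        by (simp add: has_real_derivative_iff_has_vector_derivative has_vector_derivative_at_within)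
    qed simp
    moreover have "sin (2 * (real i * pi)) = 0"
      using sin_npi[of "2 * i"] by (simp add: mult.assoc)
    ultimately show ?thesis using True inner by (simp add: integral_unique del: integral_mult_right)
  next
    case False
    let ?a = "real i * pi" and ?b = "real j * pi"
    \<comment> \<open>For f = sin(ax) and g = sin(bx) the Wronskian f g' - f' g has derivative f g''
      - f'' g = (a^2 - b^2) f g, and it vanishes at 0 and 1 because both sines do.\<close>
    let ?F = "\<lambda>x. 2 * (?b * (sin (?a * x) * cos (?b * x)) - ?a * (cos (?a * x) * sin (?b * x))) / (?a\<^sup>2 - ?b\<^sup>2)"
    have ne: "?a\<^sup>2 - ?b\<^sup>2 \<noteq> 0" using False by (simp add: power_mult_distrib)
    have "((\<lambda>x. 2 * (sin (?a * x) * sin (?b * x))) has_integral (?F 1 - ?F 0)) {0..1}"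
    proof (rule fundamental_theorem_of_calculus)
      fix x :: real
      have "(?F has_real_derivative 2 * ((?a\<^sup>2 - ?b\<^sup>2) * (sin (?a * x) * sin (?b * x))) / (?a\<^sup>2 - ?b\<^sup>2)) (at x)"
        by (rule DERIV_cdivide, rule DERIV_cmult)
          (auto intro!: derivative_eq_intros simp: algebra_simps power2_eq_square)
      also have "2 * ((?a\<^sup>2 - ?b\<^sup>2) * (sin (?a * x) * sin (?b * x))) / (?a\<^sup>2 - ?b\<^sup>2) = 2 * (sin (?a * x) * sin (?b * x))"
        using ne by (simp add: field_simps)
      finally show "(?F has_vector_derivative 2 * (sin (?a * x) * sin (?b * x))) (at x within {0..1})"
        by (simp add: has_real_derivative_iff_has_vector_derivative has_vector_derivative_at_within)
    qed simp
    then show ?thesis using False inner by (simp add: integral_unique del: integral_mult_right)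
  qed
qed

section \<open>The Galerkin space in coordinates\<close>

text \<open>One form for all operators met on \<open>Hn n\<close>: the multipliers 1,
  \<open>- eigenval i\<close>, exponentials, \<open>sqrt (q i)\<close> and
  \<open>1 / sqrt (q i)\<close> give the projection, \<open>An n\<close>, its semigroup, the noise
  operator and the inverse of the latter. Composition multiplies the coefficients.\<close>

definition diag_trunc :: "nat \<Rightarrow> (nat \<Rightarrow> real) \<Rightarrow> L2 \<Rightarrow> L2" where
  "diag_trunc n c u = (\<Sum>i=1..n. (c i * inner u (eigenfun i)) *\<^sub>R eigenfun i)"

lemma sum_eigenfun_in_Hn: "(\<Sum>i=1..n. a i *\<^sub>R eigenfun i) \<in> Hn n"
  unfolding Hn_def by (intro span_sum span_scale span_base) auto

lemma diag_trunc_in_Hn [simp]: "diag_trunc n c u \<in> Hn n"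
  unfolding diag_trunc_def by (rule sum_eigenfun_in_Hn)

lemma inner_sum_eigenfun:
  assumes "1 \<le> j" "j \<le> n"
  shows "inner (\<Sum>i=1..n. a i *\<^sub>R eigenfun i) (eigenfun j) = a j"
proof -
  have "inner (\<Sum>i=1..n. a i *\<^sub>R eigenfun i) (eigenfun j) = (\<Sum>i=1..n. if i = j then a j else 0)"
    unfolding inner_sum_left using assms by (intro sum.cong) (auto simp: inner_eigenfun)
  then show ?thesis using assms by simp
qed

lemma inner_diag_trunc:
  "1 \<le> j \<Longrightarrow> j \<le> n \<Longrightarrow> inner (diag_trunc n c u) (eigenfun j) = c j * inner u (eigenfun j)"
  unfolding diag_trunc_def by (rule inner_sum_eigenfun)

lemma Hn_expand:
  assumes "u \<in> Hn n"
  shows "u = (\<Sum>i=1..n. inner u (eigenfun i) *\<^sub>R eigenfun i)"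
  using assms unfolding Hn_def
proof (induction rule: span_induct_alt)
  case base
  then show ?case by simp
next
  case (step c x y)
  then obtain j where j: "x = eigenfun j" "1 \<le> j" "j \<le> n" by auto
  have "(\<Sum>i=1..n. inner x (eigenfun i) *\<^sub>R eigenfun i) = (\<Sum>i=1..n. if i = j then eigenfun i else 0)"
    using j by (intro sum.cong) (auto simp: inner_eigenfun)
  then have "(\<Sum>i=1..n. inner x (eigenfun i) *\<^sub>R eigenfun i) = x" using j by simp
  moreover have "(\<Sum>i=1..n. inner (c *\<^sub>R x + y) (eigenfun i) *\<^sub>R eigenfun i)
      = c *\<^sub>R (\<Sum>i=1..n. inner x (eigenfun i) *\<^sub>R eigenfun i) + (\<Sum>i=1..n. inner y (eigenfun i) *\<^sub>R eigenfun i)"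
    by (simp add: inner_add_left scaleR_add_left sum.distrib scaleR_sum_right)
  ultimately show ?case using step by simp
qed

lemma Hn_eqI:
  assumes "u \<in> Hn n" "v \<in> Hn n"
    and "\<And>i. 1 \<le> i \<Longrightarrow> i \<le> n \<Longrightarrow> inner u (eigenfun i) = inner v (eigenfun i)"
  shows "u = v"
  by (subst Hn_expand[OF assms(1)], subst Hn_expand[OF assms(2)]) (auto intro!: sum.cong simp: assms(3))

lemma diag_trunc_diag_trunc:
  "diag_trunc n c (diag_trunc n d u) = diag_trunc n (\<lambda>i. c i * d i) u"
  by (rule Hn_eqI[where n = n]) (auto simp: inner_diag_trunc)

lemma inner_Hn:
  assumes "u \<in> Hn n"
  shows "inner u v = (\<Sum>i=1..n. inner u (eigenfun i) * inner v (eigenfun i))"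
  by (subst Hn_expand[OF assms]) (simp add: inner_sum_left inner_commute[of v])

lemma norm_Hn_sq:
  assumes "u \<in> Hn n"
  shows "(norm u)\<^sup>2 = (\<Sum>i=1..n. (inner u (eigenfun i))\<^sup>2)"
  using inner_Hn[OF assms, of u] by (simp only: power2_norm_eq_inner) (simp add: power2_eq_square)

lemma norm_diag_trunc_le_Hn:
  assumes "u \<in> Hn n" "0 \<le> C" "\<And>i. 1 \<le> i \<Longrightarrow> i \<le> n \<Longrightarrow> \<bar>c i\<bar> \<le> C"
  shows "norm (diag_trunc n c u) \<le> C * norm u"
proof (rule power2_le_imp_le)
  have "(norm (diag_trunc n c u))\<^sup>2 = (\<Sum>i=1..n. (c i)\<^sup>2 * (inner u (eigenfun i))\<^sup>2)"
    by (subst norm_Hn_sq[OF diag_trunc_in_Hn]) (auto intro!: sum.cong simp: inner_diag_trunc power_mult_distrib)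
  also have "\<dots> \<le> (\<Sum>i=1..n. C\<^sup>2 * (inner u (eigenfun i))\<^sup>2)"
    using assms by (intro sum_mono mult_right_mono) (auto intro!: abs_le_square_iff[THEN iffD1])
  also have "\<dots> = (C * norm u)\<^sup>2"
    by (simp add: norm_Hn_sq[OF assms(1)] power_mult_distrib sum_distrib_left)
  finally show "(norm (diag_trunc n c u))\<^sup>2 \<le> (C * norm u)\<^sup>2" .
qed (use assms in simp)

lemma bounded_linear_diag_trunc: "bounded_linear (diag_trunc n c)"
  unfolding diag_trunc_def
  by (rule bounded_linear_sum,
      rule bounded_linear_scaleR_const[OF bounded_linear_const_mult[OF bounded_linear_inner_left]])

lemma subspace_Hn: "subspace (Hn n)"
  unfolding Hn_def by (rule subspace_span)

text \<open>The truncation sees only the projection p of u, and |p|^2 = <p, u> gives |p| <= |u| by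
  Cauchy-Schwarz, which reduces the claim to \<open>Hn n\<close>.\<close>

lemma norm_diag_trunc_le:
  assumes "0 \<le> C" "\<And>i. 1 \<le> i \<Longrightarrow> i \<le> n \<Longrightarrow> \<bar>c i\<bar> \<le> C"
  shows "norm (diag_trunc n c u) \<le> C * norm u"
proof -
  let ?p = "diag_trunc n (\<lambda>i. 1) u"
  have "(norm ?p)\<^sup>2 = inner ?p u"
    unfolding norm_Hn_sq[OF diag_trunc_in_Hn] inner_Hn[OF diag_trunc_in_Hn, where v = u]
    by (intro sum.cong) (auto simp: inner_diag_trunc power2_eq_square)
  also have "\<dots> \<le> norm ?p * norm u" by (rule norm_cauchy_schwarz)
  finally have p: "norm ?p \<le> norm u" by (cases "?p = 0") (auto simp: power2_eq_square)
  have "norm (diag_trunc n c u) = norm (diag_trunc n c ?p)"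
    by (simp add: diag_trunc_diag_trunc)
  also have "\<dots> \<le> C * norm ?p" using assms by (intro norm_diag_trunc_le_Hn) auto
  also have "\<dots> \<le> C * norm u" using p assms(1) by (rule mult_left_mono)
  finally show ?thesis .
qed

section \<open>The Galerkin operators as diagonal truncations\<close>

lemma Pn_eq: "Pn n u = diag_trunc n (\<lambda>i. 1) u"
proof -
  have orth: "inner (u - diag_trunc n (\<lambda>i. 1) u) h = 0" if "h \<in> Hn n" for h
  proof -
    have "inner h u = inner h (diag_trunc n (\<lambda>i. 1) u)"
      unfolding inner_Hn[OF that, of u] inner_Hn[OF that, of "diag_trunc n (\<lambda>i. 1) u"]
      by (intro sum.cong) (auto simp: inner_diag_trunc)
    then show ?thesis by (simp add: inner_diff_left inner_commute[of h])
  qed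
  show ?thesis
    unfolding Pn_def
  proof (rule the_equality)
    fix v assume v: "v \<in> Hn n \<and> (\<forall>h\<in>Hn n. orthogonal (u - v) h)"
    show "v = diag_trunc n (\<lambda>i. 1) u"
    proof (rule Hn_eqI[where n = n])
      fix i assume i: "1 \<le> i" "i \<le> n"
      then have "eigenfun i \<in> Hn n" by (auto simp: Hn_def intro: span_base)
      then have "inner (u - v) (eigenfun i) = 0" using v by (auto simp: orthogonal_def)
      then show "inner v (eigenfun i) = inner (diag_trunc n (\<lambda>i. 1) u) (eigenfun i)"
        using i by (simp add: inner_diag_trunc inner_diff_left)
    qed (use v in auto)
  qed (use orth in \<open>auto simp: orthogonal_def\<close>)
qed

lemma An_eq:
  assumes "u \<in> Hn n"
  shows "An n u = diag_trunc n (\<lambda>i. - eigenval i) u"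
proof -
  have "lap u = (\<Sum>i=1..n. (- eigenval i * inner u (eigenfun i)) *\<^sub>R eigenfun i)"
    by (subst Hn_expand[OF assms]) (rule lap_sum_eigenfun)
  then have "An n u = diag_trunc n (\<lambda>i. 1) (diag_trunc n (\<lambda>i. - eigenval i) u)"
    by (simp add: An_def Pn_eq diag_trunc_def)
  then show ?thesis by (simp add: diag_trunc_diag_trunc)
qed

lemma An_funpow:
  assumes "u \<in> Hn n"
  shows "(An n ^^ k) u = diag_trunc n (\<lambda>i. (- eigenval i) ^ k) u"
proof (induction k)
  case 0
  show ?case by (rule Hn_eqI[where n = n]) (auto simp: assms inner_diag_trunc)
next
  case (Suc k)
  then show ?case by (simp add: An_eq diag_trunc_diag_trunc)
qed

text \<open>On \<open>Hn n\<close> the operator series is a finite sum of scalar exponential series,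
  one for each mode.\<close>

lemma exp_An_eq:
  assumes "u \<in> Hn n"
  shows "exp_An n t u = diag_trunc n (\<lambda>i. exp (- eigenval i * t)) u"
proof -
  have "(\<lambda>k. (t ^ k / fact k) *\<^sub>R (An n ^^ k) u) sums diag_trunc n (\<lambda>i. exp (- eigenval i * t)) u"
  proof -
    have "(\<lambda>k. \<Sum>i=1..n. (((- eigenval i * t) ^ k /\<^sub>R fact k) * inner u (eigenfun i)) *\<^sub>R eigenfun i)
        sums diag_trunc n (\<lambda>i. exp (- eigenval i * t)) u"
      unfolding diag_trunc_def
      by (intro sums_sum bounded_linear.sums[OF bounded_linear_scaleR_left] sums_mult2 exp_converges)
    moreover have pow: "(- eigenval i * t) ^ k = t ^ k * (- eigenval i) ^ k" for i k
      by (metis power_mult_distrib mult.commute)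
    have "(t ^ k / fact k) *\<^sub>R (An n ^^ k) u
        = (\<Sum>i=1..n. (((- eigenval i * t) ^ k /\<^sub>R fact k) * inner u (eigenfun i)) *\<^sub>R eigenfun i)" for k
      unfolding An_funpow[OF assms] diag_trunc_def scaleR_sum_right
      by (intro sum.cong refl) (simp only: pow, simp add: divide_inverse mult_ac)
    ultimately show ?thesis by simp
  qed
  then show ?thesis unfolding exp_An_def by (rule sums_unique[symmetric])
qed

lemma sqrt_op_eq:
  assumes "u \<in> Hn n" "\<And>i. i \<ge> 1 \<Longrightarrow> Q (eigenfun i) = q i *\<^sub>R eigenfun i"
  shows "sqrt_op Q u = diag_trunc n (\<lambda>i. sqrt (q i)) u"
proof -
  have 0: "inner u (eigenfun (Suc i)) = 0" if "n \<le> i" for i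
    using that by (subst Hn_expand[OF assms(1)]) (auto simp: inner_sum_left inner_eigenfun)
  \<comment> \<open>\<open>diag_op\<close> sums over \<open>Suc i\<close>, so the modes 1 to n are
    the indices below n; all later terms vanish on \<open>Hn n\<close>.\<close>
  have "sqrt_op Q u = (\<Sum>i<n. (sqrt (q (Suc i)) * inner u (eigenfun (Suc i))) *\<^sub>R eigenfun (Suc i))"
    unfolding sqrt_op_def diag_op_def
    by (subst suminf_finite[of "{..<n}"]) (auto simp: 0 assms(2) inner_eigenfun)
  also have "\<dots> = diag_trunc n (\<lambda>i. sqrt (q i)) u"
    unfolding diag_trunc_def by (rule sum.reindex_bij_witness[of _ "\<lambda>i. i - 1" Suc]) auto
  finally show ?thesis .
qed

text \<open>In the infinite-dimensional \<open>L2\<close> closed bounded sets need not be compact.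
  The cube is compact because it is a sum of n segments, added one at a time.\<close>

lemma compact_cube_Hn:
  "compact {(\<Sum>i=1..n. a i *\<^sub>R eigenfun i) | a. \<forall>i. \<bar>a i\<bar> \<le> R}" (is "compact (?K n)")
proof (induction n)
  case 0
  \<comment> \<open>Only an inclusion, since the cube is empty for negative
    \<open>R\<close>.\<close>
  have "?K 0 \<subseteq> {0}" by auto
  then have "finite (?K 0)" by (rule finite_subset) simp
  then show ?case by (rule finite_imp_compact)
next
  case (Suc n)
  let ?I = "(\<lambda>r. r *\<^sub>R eigenfun (Suc n)) ` {-R..R}"
  have "compact ?I" by (intro compact_continuous_image continuous_intros compact_Icc)
  moreover have "?K (Suc n) = {x + y | x y. x \<in> ?K n \<and> y \<in> ?I}"
  proof (intro set_eqI iffI)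
    fix v assume "v \<in> ?K (Suc n)"
    then obtain a where a: "\<forall>i. \<bar>a i\<bar> \<le> R" "v = (\<Sum>i=1..Suc n. a i *\<^sub>R eigenfun i)" by auto
    then have "v = (\<Sum>i=1..n. a i *\<^sub>R eigenfun i) + a (Suc n) *\<^sub>R eigenfun (Suc n)" by simp
    moreover have "a (Suc n) \<in> {-R..R}" using a(1)[rule_format, of "Suc n"] by auto
    ultimately show "v \<in> {x + y | x y. x \<in> ?K n \<and> y \<in> ?I}" using a(1) by blast
  next
    fix v assume "v \<in> {x + y | x y. x \<in> ?K n \<and> y \<in> ?I}"
    then obtain x y where xy: "v = x + y" "x \<in> ?K n" "y \<in> ?I" by blast
    obtain a where a: "\<forall>i. \<bar>a i\<bar> \<le> R" "x = (\<Sum>i=1..n. a i *\<^sub>R eigenfun i)" using xy(2) by blast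
    obtain r where r: "\<bar>r\<bar> \<le> R" "y = r *\<^sub>R eigenfun (Suc n)" using xy(3) by (metis (no_types, lifting) abs_le_iff atLeastAtMost_iff imageE minus_le_iff)
    have "v = (\<Sum>i=1..Suc n. (a(Suc n := r)) i *\<^sub>R eigenfun i)" using xy(1) a(2) r(2) by simp
    moreover have "\<forall>i. \<bar>(a(Suc n := r)) i\<bar> \<le> R" using a(1) r(1) by simp
    ultimately show "v \<in> ?K (Suc n)" by blast
  qed
  ultimately show ?case using compact_sums[OF Suc] by simp
qed

lemma norm_eigenfun: "i \<ge> 1 \<Longrightarrow> norm (eigenfun i) = 1"
  by (simp add: norm_eq_sqrt_inner inner_eigenfun)

text \<open>By Cauchy-Schwarz a bounded subset of \<open>Hn n\<close> lies in a cube, and closedness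
  relative to \<open>Hn n\<close> passes to the smaller set.\<close>

lemma compact_bounded_closedin_Hn:
  assumes "closedin (top_of_set (Hn n)) S" "bounded S"
  shows "compact S"
proof -
  obtain R where R: "\<And>u. u \<in> S \<Longrightarrow> norm u \<le> R" "R > 0"
    using assms(2) by (auto simp: bounded_pos)
  let ?K = "{(\<Sum>i=1..n. a i *\<^sub>R eigenfun i) | a. \<forall>i. \<bar>a i\<bar> \<le> R}"
  have SH: "S \<subseteq> Hn n" using assms(1) closedin_imp_subset by blast
  have "S \<subseteq> ?K"
  proof
    fix u assume u: "u \<in> S"
    \<comment> \<open>The cube bounds every coefficient, including those beyond n, so the latter are
      set to 0.\<close>
    let ?a = "\<lambda>i. if 1 \<le> i \<and> i \<le> n then inner u (eigenfun i) else 0"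
    have 1: "u = (\<Sum>i=1..n. ?a i *\<^sub>R eigenfun i)"
      using Hn_expand[of u n] u SH by auto
    have 2: "\<bar>?a i\<bar> \<le> R" for i
      using Cauchy_Schwarz_ineq2[of u "eigenfun i"] R(1)[OF u] R(2) by (auto simp: norm_eigenfun)
    show "u \<in> ?K" by (rule CollectI, rule exI[of _ ?a]) (use 1 2 in \<open>intro conjI allI\<close>)
  qed
  moreover have "?K \<subseteq> Hn n" using sum_eigenfun_in_Hn by blast
  ultimately have "closedin (top_of_set ?K) S"
    using assms(1) closedin_subset_trans by blast
  then show ?thesis using compact_cube_Hn closedin_compact by blast
qed

section \<open>The controlled equation\<close>

locale galerkin =
  fixes Q F :: "L2 \<Rightarrow> L2" and q :: "nat \<Rightarrow> real" and L\<^sub>F :: real and n :: nat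
  assumes Q_eigen: "\<And>i. i \<ge> 1 \<Longrightarrow> Q (eigenfun i) = q i *\<^sub>R eigenfun i"
    and q_pos: "\<And>i. i \<ge> 1 \<Longrightarrow> q i > 0"
    and L\<^sub>F_pos: "L\<^sub>F > 0"
    and F_lipschitz: "\<And>u v. norm (F u - F v) \<le> L\<^sub>F * norm (u - v)"
    and F_zero: "F 0 = 0"
    and L\<^sub>F_less: "L\<^sub>F < eigenval 1"
begin

text \<open>For i between 1 and n, the i-th coordinate of the forcing F_n(z(s)) + Q_n^{1/2} psi(s).
  The linear part is absent because the exponential of the mild formula accounts for it.\<close>

definition drift_coord :: "(real \<Rightarrow> L2) \<Rightarrow> (real \<Rightarrow> L2) \<Rightarrow> real \<Rightarrow> nat \<Rightarrow> real" where
  "drift_coord z \<psi> s i = inner (F (z s)) (eigenfun i) + sqrt (q i) * inner (\<psi> s) (eigenfun i)"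

definition energy :: "real \<Rightarrow> (real \<Rightarrow> L2) \<Rightarrow> real" where
  "energy T \<psi> = (LINT t|lebesgue_on {0<..<T}. (norm (\<psi> t))\<^sup>2)"

text \<open>Merges the nested infima over paths and over controls: the quasi-potential at
  \<open>v\<close> is half the infimum of \<open>energy T \<psi>\<close> over all triples that steer
  to \<open>v\<close>.\<close>

definition steers :: "real \<Rightarrow> (real \<Rightarrow> L2) \<Rightarrow> (real \<Rightarrow> L2) \<Rightarrow> L2 \<Rightarrow> bool" where
  "steers T \<psi> z v \<longleftrightarrow> T > 0 \<and> \<psi> \<in> controls n T \<and> mild_solution F Q n T 0 \<psi> z \<and> z 0 = 0 \<and> z T = v"

lemma energy_nonneg: "energy T \<psi> \<ge> 0"
  by (simp add: energy_def)

lemma quasi_potential_lessD: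
  assumes "quasi_potential F Q n v < c"
  obtains T \<psi> z where "steers T \<psi> z v" "ennreal (energy T \<psi>) / 2 < c"
proof -
  obtain T z where T: "T > 0" "z 0 = 0" "z T = v" "action F Q n T 0 z < c"
    using assms unfolding quasi_potential_def Inf_less_iff by auto
  have "(INF \<psi>\<in>{\<psi> \<in> controls n T. mild_solution F Q n T 0 \<psi> z}. ennreal (energy T \<psi>)) < c * 2"
    using T(4) unfolding action_def energy_def by (subst (asm) divide_less_ennreal) simp_all
  then obtain \<psi> where "\<psi> \<in> controls n T" "mild_solution F Q n T 0 \<psi> z" "ennreal (energy T \<psi>) < c * 2"
    unfolding Inf_less_iff by auto
  then show thesis using T that[of T \<psi> z] by (simp add: steers_def divide_less_ennreal)
qed

lemma quasi_potential_le:
  assumes "steers T \<psi> z v"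
  shows "quasi_potential F Q n v \<le> ennreal (energy T \<psi> / 2)"
proof -
  have "quasi_potential F Q n v \<le> action F Q n T 0 z"
    unfolding quasi_potential_def using assms
    by (intro Inf_lower) (auto simp: steers_def mild_solution_def)
  also have "\<dots> \<le> ennreal (energy T \<psi>) / 2"
    unfolding action_def energy_def using assms
    by (intro divide_right_mono_ennreal INF_lower) (auto simp: steers_def)
  finally show ?thesis by (simp add: ennreal_divide_numeral energy_nonneg)
qed

text \<open>All operators are diagonal on \<open>Hn n\<close>, so pairing with the eigenfunctions
  turns the vector-valued integral into n real ones, and the expansion in \<open>Hn n\<close>
  recovers it from them.\<close>

lemma mild_solution_iff:
  assumes \<psi>: "\<psi> \<in> controls n T" and z: "z \<in> paths n T"
  shows "mild_solution F Q n T 0 \<psi> z \<longleftrightarrow>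
    (\<forall>t\<in>{0..T}. \<forall>i\<in>{1..n}.
      ((\<lambda>s. exp (- eigenval i * (t - s)) * drift_coord z \<psi> s i) has_integral inner (z t) (eigenfun i)) {0..t})"
proof -
  have "((\<lambda>s. exp_An n (t - s) (Pn n (F (z s)) + Pn n (sqrt_op Q (\<psi> s)))) has_integral (z t - exp_An n t 0)) {0..t}
      \<longleftrightarrow> (\<forall>i\<in>{1..n}. ((\<lambda>s. exp (- eigenval i * (t - s)) * drift_coord z \<psi> s i)
        has_integral inner (z t) (eigenfun i)) {0..t})" (is "(?f has_integral _) _ \<longleftrightarrow> ?R")
    if t: "t \<in> {0..T}" for t
  proof -
    let ?h = "\<lambda>s. \<Sum>i=1..n. (exp (- eigenval i * (t - s)) * drift_coord z \<psi> s i) *\<^sub>R eigenfun i"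
    have zt: "z t \<in> Hn n" using z t by (auto simp: paths_def)
    \<comment> \<open>A control is known to take values in \<open>Hn n\<close> only on the open
      interval, so both endpoints are left out; two points do not affect the integral.\<close>
    have eq: "?f s = ?h s" if s: "s \<in> {0..t} - {0, t}" for s
    proof -
      have \<psi>s: "\<psi> s \<in> Hn n" using \<psi> s t by (auto simp: controls_def)
      have H: "Pn n (F (z s)) + Pn n (sqrt_op Q (\<psi> s)) \<in> Hn n"
        by (simp add: Pn_eq subspace_add subspace_Hn)
      show ?thesis
      proof (rule Hn_eqI[where n = n])
        show "?f s \<in> Hn n" by (simp add: exp_An_eq[OF H])
        show "?h s \<in> Hn n" by (rule sum_eigenfun_in_Hn)
        fix i assume i: "1 \<le> i" "i \<le> n"
        show "inner (?f s) (eigenfun i) = inner (?h s) (eigenfun i)"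
          unfolding exp_An_eq[OF H] inner_sum_eigenfun[OF i] inner_diag_trunc[OF i]
          by (simp add: Pn_eq sqrt_op_eq[OF \<psi>s Q_eigen] inner_add_left inner_diag_trunc[OF i] drift_coord_def)
      qed
    qed
    have 0: "exp_An n t 0 = 0"
      using subspace_0[OF subspace_Hn] by (simp add: exp_An_eq diag_trunc_def)
    have "(?f has_integral z t) {0..t} \<longleftrightarrow> (?h has_integral z t) {0..t}"
      using eq by (intro has_integral_spike_finite_eq[of "{0, t}"]) auto
    also have "\<dots> \<longleftrightarrow> ?R"
    proof (intro iffI ballI)
      fix i assume h: "(?h has_integral z t) {0..t}" and i: "i \<in> {1..n}"
      show "((\<lambda>s. exp (- eigenval i * (t - s)) * drift_coord z \<psi> s i) has_integral inner (z t) (eigenfun i)) {0..t}"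
        using has_integral_linear[OF h bounded_linear_inner_left[of "eigenfun i"]] i
        unfolding o_def by (subst (asm) inner_sum_eigenfun) auto
    next
      assume R: ?R
      have "(?h has_integral (\<Sum>i=1..n. inner (z t) (eigenfun i) *\<^sub>R eigenfun i)) {0..t}"
        using R by (intro has_integral_sum has_integral_scaleR_left) auto
      then show "(?h has_integral z t) {0..t}" using Hn_expand[OF zt] by simp
    qed
    finally show ?thesis by (simp add: 0)
  qed
  then show ?thesis using z by (auto simp: mild_solution_def)
qed

section \<open>A priori bound on the endpoint in terms of the energy\<close>

lemma continuous_on_F: "continuous_on A F"
proof (rule continuous_at_imp_continuous_on, rule ballI)
  fix x
  show "isCont F x" unfolding continuous_at_eps_delta
  proof (intro allI impI)
    fix e :: real assume e: "e > 0"
    have "dist (F y) (F x) < e" if "dist y x < e / L\<^sub>F" for y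
      using F_lipschitz[of y x] that L\<^sub>F_pos by (simp add: dist_norm field_simps)
    then show "\<exists>d>0. \<forall>y. dist y x < d \<longrightarrow> dist (F y) (F x) < e"
      using e L\<^sub>F_pos by (intro exI[of _ "e / L\<^sub>F"]) auto
  qed
qed

lemma norm_F_le: "norm (F u) \<le> L\<^sub>F * norm u"
  using F_lipschitz[of u 0] by (simp add: F_zero)

lemma control_integrable:
  assumes "\<psi> \<in> controls n T"
  shows "(\<lambda>t. (norm (\<psi> t))\<^sup>2) integrable_on {0..T}"
    and "energy T \<psi> = integral {0..T} (\<lambda>t. (norm (\<psi> t))\<^sup>2)"
proof -
  have i: "integrable (lebesgue_on {0<..<T}) (\<lambda>t. (norm (\<psi> t))\<^sup>2)"
    using assms by (simp add: controls_def)
  have "((\<lambda>t. (norm (\<psi> t))\<^sup>2) has_integral energy T \<psi>) {0<..<T}"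
    unfolding energy_def by (rule has_integral_integral_lebesgue_on[OF i]) simp
  then have "((\<lambda>t. (norm (\<psi> t))\<^sup>2) has_integral energy T \<psi>) {0..T}"
    by (simp add: has_integral_Icc_iff_Ioo)
  then show "(\<lambda>t. (norm (\<psi> t))\<^sup>2) integrable_on {0..T}"
    "energy T \<psi> = integral {0..T} (\<lambda>t. (norm (\<psi> t))\<^sup>2)"
    by (auto simp: integral_unique)
qed

lemma eigenval_mono: "i \<le> j \<Longrightarrow> eigenval i \<le> eigenval j"
  by (simp add: eigenval_def mult_left_mono power_mono)

text \<open>With M the maximum of |z|, the mild formula yields M <= (L_F M + 1) / lambda_1 + c^2 E,
  where E is the energy; solving for M gives the bound. The 1 comes from estimating c |psi| by 1 +
  c^2 |psi|^2: the constant is integrated against the decaying kernel, and only the square, which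
  the energy controls, is integrated without it. Hence \<open>T\<close> does not enter.\<close>

lemma steered_bounded:
  obtains c where "\<And>T \<psi> z v. steers T \<psi> z v \<Longrightarrow> norm v \<le> (1 + eigenval 1 * c * energy T \<psi>) / (eigenval 1 - L\<^sub>F)"
proof -
  obtain c where c: "c > 0" "\<And>u. norm (diag_trunc n (\<lambda>i. sqrt (q i)) u) \<le> norm u * c"
    using bounded_linear.pos_bounded[OF bounded_linear_diag_trunc] by blast
  let ?lam = "eigenval 1"
  have \<lambda>: "?lam > 0" by (simp add: eigenval_def)
  have "norm v \<le> (1 + ?lam * c\<^sup>2 * energy T \<psi>) / (?lam - L\<^sub>F)" if st: "steers T \<psi> z v" for T \<psi> z v
  proof -
    have T: "T > 0" and \<psi>: "\<psi> \<in> controls n T" and mild: "mild_solution F Q n T 0 \<psi> z" and zT: "z T = v"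
      using st by (auto simp: steers_def)
    have z: "z \<in> paths n T" using mild by (simp add: mild_solution_def)
    then have "continuous_on {0..T} (\<lambda>t. norm (z t))"
      by (intro continuous_intros) (simp add: paths_def)
    then obtain t where t: "t \<in> {0..T}" and max: "\<And>s. s \<in> {0..T} \<Longrightarrow> norm (z s) \<le> norm (z t)"
      using continuous_attains_sup[of "{0..T}" "\<lambda>t. norm (z t)"] T by auto
    define M where "M = norm (z t)"
    have M: "M \<ge> 0" by (simp add: M_def)
    have zt: "z t \<in> Hn n" using z t by (auto simp: paths_def)
    let ?E = "\<lambda>s. exp (- ?lam * (t - s))"
    \<comment> \<open>Pairing the mild formula at the maximum point t with z(t) itself makes the
      left side M^2 and leaves one real integral to estimate.\<close>
    let ?g = "\<lambda>s. \<Sum>i=1..n. inner (z t) (eigenfun i) * (exp (- eigenval i * (t - s)) * drift_coord z \<psi> s i)"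
    have "(?g has_integral (\<Sum>i=1..n. inner (z t) (eigenfun i) * inner (z t) (eigenfun i))) {0..t}"
      using mild t unfolding mild_solution_iff[OF \<psi> z]
      by (intro has_integral_sum has_integral_mult_right) auto
    then have g: "(?g has_integral M\<^sup>2) {0..t}"
      unfolding M_def norm_Hn_sq[OF zt] by (simp add: power2_eq_square)
    define J where "J = integral {0..t} (\<lambda>s. (norm (\<psi> s))\<^sup>2)"
    have sub: "{0..t} \<subseteq> {0..T}" using t by auto
    have int: "(\<lambda>s. (norm (\<psi> s))\<^sup>2) integrable_on {0..t}"
      using integrable_subinterval_real[OF control_integrable(1)[OF \<psi>] sub] .
    have J: "J \<le> energy T \<psi>"
      unfolding J_def control_integrable(2)[OF \<psi>]
      by (rule integral_subset_le[OF sub int control_integrable(1)[OF \<psi>]]) simp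
    have "(?E has_integral (?E t / ?lam - ?E 0 / ?lam)) {0..t}"
    proof (rule fundamental_theorem_of_calculus)
      show "((\<lambda>s. ?E s / ?lam) has_vector_derivative ?E s) (at s within {0..t})" for s
        unfolding has_real_derivative_iff_has_vector_derivative[symmetric]
        using \<lambda> by (auto intro!: derivative_eq_intros)
    qed (use t in simp)
    then have h: "((\<lambda>s. M * (?E s * (L\<^sub>F * M + 1) + c\<^sup>2 * (norm (\<psi> s))\<^sup>2)) has_integral
        M * ((?E t / ?lam - ?E 0 / ?lam) * (L\<^sub>F * M + 1) + c\<^sup>2 * J)) {0..t}"
      unfolding J_def
      by (intro has_integral_mult_right has_integral_add has_integral_mult_left integrable_integral int)
    have "M\<^sup>2 \<le> M * ((?E t / ?lam - ?E 0 / ?lam) * (L\<^sub>F * M + 1) + c\<^sup>2 * J)"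
    proof (rule has_integral_le[OF g h])
      fix s assume s: "s \<in> {0..t}"
      \<comment> \<open>The exponential is self-adjoint, so it is moved onto z(t), where it costs at
        most the factor exp(-lambda_1 (t - s)) of the slowest mode.\<close>
      let ?u = "diag_trunc n (\<lambda>i. exp (- eigenval i * (t - s))) (z t)"
      have "?g s = (\<Sum>i=1..n. inner ?u (eigenfun i) * inner (F (z s)) (eigenfun i))
          + (\<Sum>i=1..n. inner ?u (eigenfun i) * inner (diag_trunc n (\<lambda>i. sqrt (q i)) (\<psi> s)) (eigenfun i))"
        unfolding sum.distrib[symmetric]
        by (intro sum.cong) (auto simp: inner_diag_trunc drift_coord_def algebra_simps)
      also have "\<dots> = inner ?u (F (z s)) + inner ?u (diag_trunc n (\<lambda>i. sqrt (q i)) (\<psi> s))"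
        by (simp only: inner_Hn[OF diag_trunc_in_Hn, where v = "F (z s)"]
            inner_Hn[OF diag_trunc_in_Hn, where v = "diag_trunc n (\<lambda>i. sqrt (q i)) (\<psi> s)"])
      also have "\<dots> \<le> norm ?u * norm (F (z s)) + norm ?u * norm (diag_trunc n (\<lambda>i. sqrt (q i)) (\<psi> s))"
        by (intro add_mono norm_cauchy_schwarz)
      also have "\<dots> \<le> (?E s * M) * (L\<^sub>F * M) + (?E s * M) * (norm (\<psi> s) * c)"
      proof -
        have "norm ?u \<le> ?E s * norm (z t)"
          using s by (intro norm_diag_trunc_le) (auto intro!: mult_right_mono eigenval_mono)
        moreover have "norm (F (z s)) \<le> L\<^sub>F * M"
          using norm_F_le[of "z s"] mult_left_mono[OF max[of s] less_imp_le[OF L\<^sub>F_pos]] s sub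
          unfolding M_def by auto
        ultimately show ?thesis using c M by (intro add_mono mult_mono) (auto simp: M_def)
      qed
      also have "\<dots> = M * (?E s * (L\<^sub>F * M + c * norm (\<psi> s)))" by (simp add: algebra_simps)
      also have "\<dots> \<le> M * (?E s * (L\<^sub>F * M + 1) + c\<^sup>2 * (norm (\<psi> s))\<^sup>2)"
      proof (rule mult_left_mono[OF _ M])
        have "c * norm (\<psi> s) \<le> 1 + (c * norm (\<psi> s))\<^sup>2"
          using zero_le_power2[of "c * norm (\<psi> s) - 1/2"] by (simp add: power2_diff power_divide)
        then have "?E s * (c * norm (\<psi> s)) \<le> ?E s * 1 + ?E s * (c * norm (\<psi> s))\<^sup>2"
          by (metis distrib_left exp_ge_zero mult_left_mono)
        also have "?E s * (c * norm (\<psi> s))\<^sup>2 \<le> (c * norm (\<psi> s))\<^sup>2"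
          using s \<lambda> by (intro mult_left_le_one_le) auto
        finally show "?E s * (L\<^sub>F * M + c * norm (\<psi> s)) \<le> ?E s * (L\<^sub>F * M + 1) + c\<^sup>2 * (norm (\<psi> s))\<^sup>2"
          by (simp add: algebra_simps)
      qed
      finally show "?g s \<le> M * (?E s * (L\<^sub>F * M + 1) + c\<^sup>2 * (norm (\<psi> s))\<^sup>2)" .
    qed
    also have "\<dots> \<le> M * (1 / ?lam * (L\<^sub>F * M + 1) + c\<^sup>2 * energy T \<psi>)"
      using M \<lambda> L\<^sub>F_pos J by (intro mult_left_mono add_mono mult_right_mono) auto
    \<comment> \<open>Dividing by M requires M > 0; for M = 0 the resulting bound holds because its
      right side is nonnegative.\<close>
    finally have "M = 0 \<or> M \<le> 1 / ?lam * (L\<^sub>F * M + 1) + c\<^sup>2 * energy T \<psi>"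
      using M by (auto simp: power2_eq_square mult_le_cancel_left less_le)
    then have "M \<le> 1 / ?lam * (L\<^sub>F * M + 1) + c\<^sup>2 * energy T \<psi>"
      using \<lambda> L\<^sub>F_pos energy_nonneg[of T \<psi>] by auto
    then have "M * (?lam - L\<^sub>F) \<le> 1 + ?lam * c\<^sup>2 * energy T \<psi>"
      using \<lambda> by (simp add: field_simps)
    then have "M \<le> (1 + ?lam * c\<^sup>2 * energy T \<psi>) / (?lam - L\<^sub>F)"
      using L\<^sub>F_less by (simp add: pos_le_divide_eq)
    moreover have "norm v \<le> M" using max[of T] T zT by (simp add: M_def)
    ultimately show ?thesis by simp
  qed
  then show thesis by (rule that)
qed
end

section \<open>Lower semicontinuity and compact level sets\<close>

text \<open>Energy is additive over consecutive time intervals, and a control of norm at most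
  \<open>K\<close> costs at most \<open>K\<^sup>2\<close> per unit of time.\<close>

lemma controls_append:
  assumes \<psi>: "\<psi> \<in> controls n T" and T: "T > 0" "\<tau> > 0"
    and \<eta>: "continuous_on UNIV \<eta>" "range \<eta> \<subseteq> Hn n" "\<And>s. s \<in> {0..\<tau>} \<Longrightarrow> norm (\<eta> s) \<le> K"
  defines "\<psi>' \<equiv> \<lambda>t. if t < T then \<psi> t else \<eta> (t - T)"
  shows "\<psi>' \<in> controls n (T + \<tau>)"
    and "(LINT t|lebesgue_on {0<..<T + \<tau>}. (norm (\<psi>' t))\<^sup>2)
      \<le> (LINT t|lebesgue_on {0<..<T}. (norm (\<psi> t))\<^sup>2) + K\<^sup>2 * \<tau>"
proof -
  have c: "continuous_on A (\<lambda>t. \<eta> (t - T))" for A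
    by (rule continuous_on_compose2[OF \<eta>(1)]) (auto intro!: continuous_intros)
  have m: "\<psi>' \<in> borel_measurable (lebesgue_on {0<..<T + \<tau>})"
    unfolding \<psi>'_def
  proof (subst measurable_If_restrict_space_iff)
    show "{x \<in> space (lebesgue_on {0<..<T + \<tau>}). x < T} \<in> sets (lebesgue_on {0<..<T + \<tau>})"
    proof -
      have "{x \<in> space (lebesgue_on {0<..<T + \<tau>}). x < T} = {0<..<T}" using T by auto
      moreover have "{0<..<T} \<subseteq> {0<..<T + \<tau>}" using T by auto
      ultimately show ?thesis by (simp add: sets_restrict_space_iff)
    qed
    have "restrict_space (lebesgue_on {0<..<T + \<tau>}) {x. x < T} = lebesgue_on {0<..<T}"
      using T by (subst restrict_restrict_space) (auto intro!: arg_cong[where f = "restrict_space lebesgue"])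
    moreover have "(\<lambda>t. \<eta> (t - T)) \<in> borel_measurable lebesgue"
      by (intro measurable_completion) (simp add: borel_measurable_continuous_onI c)
    ultimately show "\<psi> \<in> borel_measurable (restrict_space (lebesgue_on {0<..<T + \<tau>}) {x. x < T}) \<and>
      (\<lambda>t. \<eta> (t - T)) \<in> borel_measurable (restrict_space (lebesgue_on {0<..<T + \<tau>}) {x. \<not> x < T})"
      using \<psi> by (auto simp: controls_def intro!: measurable_restrict_space1)
  qed
  have H: "\<psi>' ` {0<..<T + \<tau>} \<subseteq> Hn n"
    using \<psi> \<eta>(2) by (auto simp: controls_def \<psi>'_def)
  let ?a = "\<lambda>t. indicator {0<..<T} t *\<^sub>R (norm (\<psi> t))\<^sup>2"
  \<comment> \<open>The interval is closed at T because the spliced control already follows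
    \<open>\<eta>\<close> there; the two indicators then add up exactly to that of the whole open
    interval.\<close>
  let ?b = "\<lambda>t. indicator {T..<T + \<tau>} t *\<^sub>R (norm (\<eta> (t - T)))\<^sup>2"
  let ?k = "\<lambda>t. indicator {T..<T + \<tau>} t *\<^sub>R K\<^sup>2"
  have eq: "indicator {0<..<T + \<tau>} t *\<^sub>R (norm (\<psi>' t))\<^sup>2 = ?a t + ?b t" for t
    using T by (auto simp: \<psi>'_def split: split_indicator)
  have a: "integrable lebesgue ?a"
    using \<psi> by (simp add: controls_def integrable_restrict_space)
  have "integrable (lebesgue_on {T..T + \<tau>}) (\<lambda>t. (norm (\<eta> (t - T)))\<^sup>2)"
    by (intro continuous_imp_integrable_real continuous_intros c)
  then have "set_integrable lebesgue {T..T + \<tau>} (\<lambda>t. (norm (\<eta> (t - T)))\<^sup>2)"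
    by (simp add: set_integrable_def integrable_restrict_space)
  then have "set_integrable lebesgue {T..<T + \<tau>} (\<lambda>t. (norm (\<eta> (t - T)))\<^sup>2)"
    by (rule set_integrable_subset) auto
  then have b: "integrable lebesgue ?b" by (simp add: set_integrable_def)
  have k: "integrable lebesgue ?k"
    by (intro integrable_scaleR_left) (use T in \<open>simp add: integrable_indicator_iff\<close>)
  have "integrable (lebesgue_on {0<..<T + \<tau>}) (\<lambda>t. (norm (\<psi>' t))\<^sup>2)"
    using Bochner_Integration.integrable_add[OF a b]
    by (subst integrable_restrict_space) (simp, simp only: eq)
  then show "\<psi>' \<in> controls n (T + \<tau>)" using m H by (simp add: controls_def)
  have "(LINT t|lebesgue_on {0<..<T + \<tau>}. (norm (\<psi>' t))\<^sup>2) = (LINT t|lebesgue. ?a t + ?b t)"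
    by (subst integral_restrict_space) (simp, simp only: eq)
  also have "\<dots> = (LINT t|lebesgue. ?a t) + (LINT t|lebesgue. ?b t)"
    by (rule Bochner_Integration.integral_add[OF a b])
  also have "(LINT t|lebesgue. ?b t) \<le> (LINT t|lebesgue. ?k t)"
  proof (rule integral_mono[OF b k])
    fix t
    show "?b t \<le> ?k t"
      using \<eta>(3)[of "t - T"] by (auto split: split_indicator intro!: power_mono)
  qed
  also have "(LINT t|lebesgue. ?k t) = K\<^sup>2 * \<tau>" using T by simp
  also have "(LINT t|lebesgue. ?a t) = (LINT t|lebesgue_on {0<..<T}. (norm (\<psi> t))\<^sup>2)"
    by (subst integral_restrict_space) simp_all
  finally show "(LINT t|lebesgue_on {0<..<T + \<tau>}. (norm (\<psi>' t))\<^sup>2)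
      \<le> (LINT t|lebesgue_on {0<..<T}. (norm (\<psi> t))\<^sup>2) + K\<^sup>2 * \<tau>" by simp
qed

context galerkin
begin

text \<open>The segment is run at unit speed, so it lasts |v - v'| and its cost is proportional to
  that distance. \<open>K\<close> depends on the target \<open>v\<close> but not on
  \<open>v'\<close>, \<open>T\<close> or the path so far, which makes the estimate usable in a
  neighbourhood of \<open>v\<close>.\<close>

lemma steers_extend:
  assumes v: "v \<in> Hn n"
  obtains K where "\<And>T \<psi> z v'. steers T \<psi> z v' \<Longrightarrow> v' \<noteq> v \<Longrightarrow> norm (v - v') \<le> 1 \<Longrightarrow>
    \<exists>T' \<psi>' z'. steers T' \<psi>' z' v \<and> energy T' \<psi>' \<le> energy T \<psi> + K\<^sup>2 * norm (v - v')"
proof -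
  obtain c where c: "c > 0" "\<And>u. norm (diag_trunc n (\<lambda>i. 1 / sqrt (q i)) u) \<le> norm u * c"
    using bounded_linear.pos_bounded[OF bounded_linear_diag_trunc] by blast
  obtain d where d: "d > 0" "\<And>u. norm (diag_trunc n eigenval u) \<le> norm u * d"
    using bounded_linear.pos_bounded[OF bounded_linear_diag_trunc] by blast
  \<comment> \<open>On the segment |y| <= |v| + 1. The three summands bound the velocity, the linear
    part and F(y); the factor \<open>c\<close> bounds the inverse of the noise operator.\<close>
  define K where "K = (1 + (norm v + 1) * d + L\<^sub>F * (norm v + 1)) * c"
  have "\<exists>T' \<psi>' z'. steers T' \<psi>' z' v \<and> energy T' \<psi>' \<le> energy T \<psi> + K\<^sup>2 * norm (v - v')"
    if st: "steers T \<psi> z v'" and ne: "v' \<noteq> v" and near: "norm (v - v') \<le> 1" for T \<psi> z v'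
  proof -
    have T: "T > 0" and \<psi>: "\<psi> \<in> controls n T" and mild: "mild_solution F Q n T 0 \<psi> z"
      and z0: "z 0 = 0" and zT: "z T = v'"
      using st by (auto simp: steers_def)
    have z: "z \<in> paths n T" using mild by (simp add: mild_solution_def)
    have v': "v' \<in> Hn n" using z T zT by (auto simp: paths_def)
    define \<tau> where "\<tau> = norm (v - v')"
    have \<tau>: "\<tau> > 0" using ne by (simp add: \<tau>_def)
    define w where "w = (v - v') /\<^sub>R \<tau>"
    have w: "norm w = 1" "w \<in> Hn n"
      using \<tau> v v' by (auto simp: w_def \<tau>_def intro!: subspace_scale subspace_diff subspace_Hn)
    define y where "y s = v' + s *\<^sub>R w" for s
    have yH: "y s \<in> Hn n" for s
      using v' w by (auto simp: y_def intro!: subspace_add subspace_scale subspace_Hn)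
    have y0: "y 0 = v'" and y\<tau>: "y \<tau> = v" using \<tau> by (auto simp: y_def w_def)
    \<comment> \<open>The equation w = A_n y + F_n(y) + Q_n^{1/2} eta solved for eta;
      \<open>eigenval\<close> is the multiplier of -A_n.\<close>
    define \<eta> where "\<eta> s = diag_trunc n (\<lambda>i. 1 / sqrt (q i)) (w + diag_trunc n eigenval (y s) - F (y s))" for s
    have cy: "continuous_on A y" for A unfolding y_def by (intro continuous_intros)
    have c\<eta>: "continuous_on UNIV \<eta>"
      unfolding \<eta>_def
      by (intro bounded_linear.continuous_on[OF bounded_linear_diag_trunc] continuous_intros cy
          continuous_on_compose2[OF continuous_on_F[of UNIV] cy]) simp
    have \<eta>K: "norm (\<eta> s) \<le> K" if s: "s \<in> {0..\<tau>}" for s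
    proof -
      \<comment> \<open>The point is measured backwards from \<open>v\<close>, so that its norm is
        bounded in terms of \<open>v\<close> alone.\<close>
      have "v = v' + \<tau> *\<^sub>R w" using \<tau> by (simp add: w_def)
      then have "y s = v - (\<tau> - s) *\<^sub>R w" by (simp add: y_def scaleR_left_diff_distrib)
      then have "norm (y s) \<le> norm v + norm ((\<tau> - s) *\<^sub>R w)" by (simp only: norm_triangle_ineq4)
      also have "norm ((\<tau> - s) *\<^sub>R w) \<le> 1" using s near w(1) by (simp add: \<tau>_def)
      finally have ys: "norm (y s) \<le> norm v + 1" by simp
      have "norm (\<eta> s) \<le> norm (w + diag_trunc n eigenval (y s) - F (y s)) * c"
        unfolding \<eta>_def by (rule c)
      also have "norm (w + diag_trunc n eigenval (y s) - F (y s))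
          \<le> norm w + norm (diag_trunc n eigenval (y s)) + norm (F (y s))"
        by (meson add_mono norm_triangle_ineq norm_triangle_ineq4 order_refl order_trans)
      also have "\<dots> \<le> 1 + (norm v + 1) * d + L\<^sub>F * (norm v + 1)"
      proof (intro add_mono)
        show "norm (diag_trunc n eigenval (y s)) \<le> (norm v + 1) * d"
          using d(2)[of "y s"] mult_right_mono[OF ys, of d] d(1) by linarith
        show "norm (F (y s)) \<le> L\<^sub>F * (norm v + 1)"
          using norm_F_le[of "y s"] mult_left_mono[OF ys, of L\<^sub>F] L\<^sub>F_pos by linarith
      qed (simp add: w)
      finally show ?thesis using c(1) by (simp add: K_def)
    qed
    define \<psi>' where "\<psi>' t = (if t < T then \<psi> t else \<eta> (t - T))" for t
    define z' where "z' t = (if t \<le> T then z t else y (t - T))" for t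
    have z'_ge: "z' t = y (t - T)" if "t \<ge> T" for t
      using that by (auto simp: z'_def y0 zT)
    have \<psi>': "\<psi>' \<in> controls n (T + \<tau>)" and en: "energy (T + \<tau>) \<psi>' \<le> energy T \<psi> + K\<^sup>2 * \<tau>"
      unfolding \<psi>'_def energy_def
      by (intro controls_append[OF \<psi> T \<tau> c\<eta> _ \<eta>K]; auto simp: \<eta>_def)+
    have z': "z' \<in> paths n (T + \<tau>)"
    proof -
      have "continuous_on {0..T + \<tau>} z'"
        unfolding z'_def
      proof (rule continuous_on_cases_1)
        show "continuous_on {t \<in> {0..T + \<tau>}. t \<le> T} z"
          using z by (auto simp: paths_def intro: continuous_on_subset)
        show "continuous_on {t \<in> {0..T + \<tau>}. T \<le> t} (\<lambda>t. y (t - T))"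
          by (rule continuous_on_compose2[OF cy[of UNIV]]) (auto intro!: continuous_intros)
      qed (simp add: zT y0)
      moreover have "z' ` {0..T + \<tau>} \<subseteq> Hn n"
        using z yH by (auto simp: paths_def z'_def)
      ultimately show ?thesis by (simp add: paths_def)
    qed
    \<comment> \<open>At time T the new control has already switched to \<open>\<eta>\<close>, so
      the two integrands may differ at that single point.\<close>
    have old: "((\<lambda>s. exp (- eigenval i * (t - s)) * drift_coord z' \<psi>' s i) has_integral inner (z t) (eigenfun i)) {0..t}"
      if t: "t \<in> {0..T}" and i: "i \<in> {1..n}" for t i
    proof (rule has_integral_spike_finite[where S = "{T}"])
      show "((\<lambda>s. exp (- eigenval i * (t - s)) * drift_coord z \<psi> s i) has_integral inner (z t) (eigenfun i)) {0..t}"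
        using mild t i unfolding mild_solution_iff[OF \<psi> z] by blast
    qed (use t in \<open>auto simp: drift_coord_def z'_def \<psi>'_def\<close>)
    have "mild_solution F Q n (T + \<tau>) 0 \<psi>' z'"
      unfolding mild_solution_iff[OF \<psi>' z']
    proof (intro ballI)
      fix t i assume t: "t \<in> {0..T + \<tau>}" and i: "i \<in> {1..n}"
      show "((\<lambda>s. exp (- eigenval i * (t - s)) * drift_coord z' \<psi>' s i) has_integral inner (z' t) (eigenfun i)) {0..t}"
      proof (cases "t \<le> T")
        case True
        then show ?thesis using old[of t i] t i by (simp add: z'_def)
      next
        case False
        let ?l = "eigenval i" and ?e = "eigenfun i"
        \<comment> \<open>The semigroup property carries the identity at time T forward to time
          t.\<close>
        have "((\<lambda>s. exp (- ?l * (t - T)) * (exp (- ?l * (T - s)) * drift_coord z' \<psi>' s i)) has_integral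
            exp (- ?l * (t - T)) * inner v' ?e) {0..T}"
          using has_integral_mult_right[OF old[of T i]] T i by (simp add: zT)
        moreover have "exp (- ?l * (t - T)) * (exp (- ?l * (T - s)) * x) = exp (- ?l * (t - s)) * x" for s x
        proof -
          have "- ?l * (t - s) = - ?l * (t - T) + - ?l * (T - s)" by (simp add: algebra_simps)
          then show ?thesis by (simp only: exp_add mult.assoc)
        qed
        ultimately have 1: "((\<lambda>s. exp (- ?l * (t - s)) * drift_coord z' \<psi>' s i) has_integral
            exp (- ?l * (t - T)) * inner v' ?e) {0..T}" by (simp only:)
        \<comment> \<open>Variation of constants: the segment's coordinate times exp(-l (t - s)) is
          an antiderivative of the integrand, because \<open>\<eta>\<close> makes the forcing equal
          to the velocity plus l times the position.\<close>
        let ?G = "\<lambda>s. exp (- ?l * (t - s)) * (inner v' ?e + (s - T) * inner w ?e)"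
        have 2: "((\<lambda>s. exp (- ?l * (t - s)) * drift_coord z' \<psi>' s i) has_integral (?G t - ?G T)) {T..t}"
        proof (rule fundamental_theorem_of_calculus)
          fix s assume s: "s \<in> {T..t}"
          have "sqrt (q i) * inner (\<psi>' s) ?e = inner (w + diag_trunc n eigenval (y (s - T)) - F (y (s - T))) ?e"
            using s i q_pos[of i] by (auto simp: \<psi>'_def \<eta>_def inner_diag_trunc)
          then have dr: "drift_coord z' \<psi>' s i = inner w ?e + ?l * (inner v' ?e + (s - T) * inner w ?e)"
            using s i by (simp add: drift_coord_def z'_ge inner_diff_left inner_add_left inner_diag_trunc)
              (simp add: y_def inner_add_left)
          have "(?G has_real_derivative exp (- ?l * (t - s)) * drift_coord z' \<psi>' s i) (at s)"
            unfolding dr by (auto intro!: derivative_eq_intros simp: algebra_simps)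
          then show "(?G has_vector_derivative exp (- ?l * (t - s)) * drift_coord z' \<psi>' s i) (at s within {T..t})"
            by (simp add: has_real_derivative_iff_has_vector_derivative has_vector_derivative_at_within)
        qed (use False in simp)
        have "inner (z' t) ?e = exp (- ?l * (t - T)) * inner v' ?e + (?G t - ?G T)"
          using False by (simp add: z'_ge y_def inner_add_left)
        then show ?thesis
          using has_integral_combine[OF _ _ 1 2] False T by simp
      qed
    qed
    moreover have "z' 0 = 0" "z' (T + \<tau>) = v"
      using T \<tau> z0 y\<tau> by (simp_all add: z'_def)
    ultimately have "steers (T + \<tau>) \<psi>' z' v"
      using T \<tau> \<psi>' by (simp add: steers_def)
    then show ?thesis using en unfolding \<tau>_def by blast
  qed
  then show thesis by (rule that)
qed

section \<open>Lower semicontinuity from the cost of a short segment\<close>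

lemma rate_function_quasi_potential:
  "rate_function (top_of_set (Hn n)) (quasi_potential F Q n)" (is "rate_function _ ?V")
  unfolding rate_function_def
proof
  fix \<alpha>
  have "\<exists>e>0. \<forall>v'\<in>Hn n. dist v' v < e \<longrightarrow> \<alpha> < ?V v'" if v: "v \<in> Hn n" "\<alpha> < ?V v" for v
  proof -
    \<comment> \<open>The value at \<open>v\<close> may be infinite; an intermediate level is finite
      and leaves a real gap b - a to spend.\<close>
    obtain \<beta> where \<beta>: "\<alpha> < \<beta>" "\<beta> < ?V v" using dense[OF v(2)] by auto
    then have "\<alpha> < top" "\<beta> < top" by (auto intro: less_le_trans)
    then obtain a b where ab: "\<alpha> = ennreal a" "\<beta> = ennreal b" "a \<ge> 0" "b \<ge> 0"
      by (metis ennreal_cases order_less_irrefl)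
    have less: "a < b" using \<beta>(1) ab by (simp add: ennreal_less_iff)
    obtain K where K: "\<And>T \<psi> z v'. steers T \<psi> z v' \<Longrightarrow> v' \<noteq> v \<Longrightarrow> norm (v - v') \<le> 1 \<Longrightarrow>
        \<exists>T' \<psi>' z'. steers T' \<psi>' z' v \<and> energy T' \<psi>' \<le> energy T \<psi> + K\<^sup>2 * norm (v - v')"
      using steers_extend[OF v(1)] by blast
    \<comment> \<open>The 1 in the minimum is the radius allowed by \<open>steers_extend\<close>;
      the added 1 keeps the denominator positive when \<open>K\<close> is 0.\<close>
    define e where "e = min 1 ((b - a) / (K\<^sup>2 + 1))"
    have "e > 0" using less by (simp add: e_def add_nonneg_pos)
    moreover have "\<alpha> < ?V v'" if v': "v' \<in> Hn n" "dist v' v < e" for v'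
    proof (rule ccontr)
      assume "\<not> \<alpha> < ?V v'"
      then have le: "?V v' \<le> ennreal a" using ab by simp
      then have ne: "v' \<noteq> v" using v(2) ab by auto
      have near: "norm (v - v') < e" using v' by (simp add: dist_norm norm_minus_commute)
      \<comment> \<open>The midpoint leaves slack for a non-optimal control: its energy is below a +
        b, the segment adds at most b - a, and half the total is at most b, contradicting the choice
        of \<open>\<beta>\<close>.\<close>
      have "?V v' < ennreal ((a + b) / 2)"
        using le less ab(3) by (auto intro!: le_less_trans[OF le] simp: ennreal_less_iff)
      then obtain T \<psi> z where st: "steers T \<psi> z v'" and en: "ennreal (energy T \<psi>) / 2 < ennreal ((a + b) / 2)"
        by (rule quasi_potential_lessD)
      have en: "energy T \<psi> < a + b"
        using en ab by (simp add: ennreal_divide_numeral energy_nonneg ennreal_less_iff)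
      obtain T' \<psi>' z' where st': "steers T' \<psi>' z' v" "energy T' \<psi>' \<le> energy T \<psi> + K\<^sup>2 * norm (v - v')"
        using K[OF st ne] near by (auto simp: e_def)
      have "K\<^sup>2 * norm (v - v') \<le> (K\<^sup>2 + 1) * norm (v - v')" by (simp add: mult_right_mono)
      also have "\<dots> \<le> (K\<^sup>2 + 1) * ((b - a) / (K\<^sup>2 + 1))"
        using near by (intro mult_left_mono) (auto simp: e_def)
      also have "\<dots> = b - a" by (simp add: add_nonneg_eq_0_iff)
      finally have "energy T' \<psi>' / 2 \<le> b" using st'(2) en by simp
      then have "?V v \<le> ennreal b"
        using quasi_potential_le[OF st'(1)] by (meson ennreal_leI order_trans)
      then show False using \<beta>(2) ab by simp
    qed
    ultimately show ?thesis by blast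
  qed
  then show "openin (top_of_set (Hn n)) {u \<in> topspace (top_of_set (Hn n)). \<alpha> < ?V u}"
    unfolding openin_euclidean_subtopology_iff by auto
qed

section \<open>Boundedness and compactness of the level sets\<close>

lemma bounded_quasi_potential_le:
  "bounded {u \<in> Hn n. quasi_potential F Q n u \<le> ennreal \<alpha>}" if "\<alpha> \<ge> 0"
proof -
  obtain c where c: "\<And>T \<psi> z v. steers T \<psi> z v \<Longrightarrow>
      norm v \<le> (1 + eigenval 1 * c * energy T \<psi>) / (eigenval 1 - L\<^sub>F)"
    using steered_bounded by blast
  \<comment> \<open>The infimum need not be attained, so the control is chosen at level
    \<open>\<alpha> + 1\<close>, with energy at most twice that. The absolute value is there because
    \<open>steered_bounded\<close> does not fix the sign of its constant.\<close>
  have "norm u \<le> (1 + eigenval 1 * \<bar>c\<bar> * (2 * (\<alpha> + 1))) / (eigenval 1 - L\<^sub>F)"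
    if "quasi_potential F Q n u \<le> ennreal \<alpha>" for u
  proof -
    have "quasi_potential F Q n u < ennreal (\<alpha> + 1)"
      using that \<open>\<alpha> \<ge> 0\<close> by (auto intro!: le_less_trans[OF that] simp: ennreal_less_iff)
    then obtain T \<psi> z where st: "steers T \<psi> z u" and en: "ennreal (energy T \<psi>) / 2 < ennreal (\<alpha> + 1)"
      by (rule quasi_potential_lessD)
    have en: "energy T \<psi> \<le> 2 * (\<alpha> + 1)"
      using en \<open>\<alpha> \<ge> 0\<close> by (simp add: ennreal_divide_numeral energy_nonneg ennreal_less_iff del: ennreal_plus)
    have "eigenval 1 * c * energy T \<psi> \<le> eigenval 1 * \<bar>c\<bar> * (2 * (\<alpha> + 1))"
      using en energy_nonneg[of T \<psi>] by (intro mult_mono[OF mult_left_mono]) (auto simp: eigenval_def)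
    then show ?thesis
      using L\<^sub>F_less by (intro order_trans[OF c[OF st]] divide_right_mono) auto
  qed
  then show ?thesis unfolding bounded_iff by blast
qed

lemma good_rate_function_quasi_potential:
  "good_rate_function (top_of_set (Hn n)) (quasi_potential F Q n)" (is "good_rate_function _ ?V")
  unfolding good_rate_function_def
proof (intro conjI allI impI)
  show rate: "rate_function (top_of_set (Hn n)) ?V" by (rule rate_function_quasi_potential)
  fix \<alpha> :: real assume "\<alpha> \<ge> 0"
  let ?S = "{u \<in> Hn n. ?V u \<le> ennreal \<alpha>}"
  have "openin (top_of_set (Hn n)) {u \<in> Hn n. ennreal \<alpha> < ?V u}"
    using rate by (simp add: rate_function_def)
  moreover have "Hn n - ?S = {u \<in> Hn n. ennreal \<alpha> < ?V u}" by auto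
  ultimately have "closedin (top_of_set (Hn n)) ?S"
    by (simp add: closedin_def)
  then have "compact ?S"
    using bounded_quasi_potential_le[OF \<open>\<alpha> \<ge> 0\<close>] by (rule compact_bounded_closedin_Hn)
  then show "compactin (top_of_set (Hn n)) {u \<in> topspace (top_of_set (Hn n)). ?V u \<le> ennreal \<alpha>}"
    by (simp add: compactin_subtopology)
qed

end
theorem theorem3p6:
  fixes Q F :: "L2 \<Rightarrow> L2" and q :: "nat \<Rightarrow> real" and L\<^sub>F L :: real and n :: nat
  assumes Q_bounded: "bounded_linear Q"
    and Q_selfadjoint: "\<And>u v. inner (Q u) v = inner u (Q v)"
    and Q_posdef: "\<And>u. u \<noteq> 0 \<Longrightarrow> inner (Q u) u > 0"
    and Q_eigen: "\<And>i. i \<ge> 1 \<Longrightarrow> Q (eigenfun i) = q i *\<^sub>R eigenfun i"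
    and q_pos: "\<And>i. i \<ge> 1 \<Longrightarrow> q i > 0"
    and dom_A_sub: "dom_A \<subseteq> range (sqrt_op Q)"
    and range_sqrt_op: "range (sqrt_op Q) \<subseteq> Hdot 1"
    and HS: "hilbert_schmidt (\<lambda>u. neg_lap_pow (1/2) (sqrt_op Q u))"
    and bounded_inv: "bounded_linear
          (\<lambda>u. inv (sqrt_op Q) (inv_into dom_A (\<lambda>w. - lap w) u))"
    and F_diff: "\<And>u. F differentiable (at u)"
    and consts_pos: "L\<^sub>F > 0" "L > 0"
    and F_lipschitz: "\<And>u v. norm (F u - F v) \<le> L\<^sub>F * norm (u - v)"
    and F_H1: "\<And>u. u \<in> Hdot 1 \<Longrightarrow>
          F u \<in> Hdot 1 \<and> Hdot_norm 1 (F u) \<le> L * (1 + Hdot_norm 1 u)"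
    and F'_H2: "\<And>u v. u \<in> Hdot 2 \<Longrightarrow> v \<in> Hdot 2 \<Longrightarrow>
          frechet_derivative F (at u) v \<in> Hdot 2 \<and>
          Hdot_norm 2 (frechet_derivative F (at u) v)
            \<le> L * (1 + (Hdot_norm 2 u)\<^sup>2) * Hdot_norm 2 v"
    and F_zero: "F 0 = 0"
    and L\<^sub>F_less: "L\<^sub>F < eigenval 1"
    and n_pos: "n \<ge> 1"
  shows "good_rate_function (top_of_set (Hn n)) (quasi_potential F Q n)"

proof -
  interpret galerkin Q F q L\<^sub>F n
    by unfold_locales (use Q_eigen q_pos consts_pos F_lipschitz F_zero L\<^sub>F_less in auto)
  show ?thesis by (rule good_rate_function_quasi_potential)
qed

end
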